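(* Assume $t\neq0$, $b_5\neq1,q^{-1/2},q^{-1}$, $f\neq0$, $b_5f\neq t$, $g\neq0$, $\hat g\neq0$ and $a_n\neq0$. Assume in addition that $$\hat g\neq\frac{1-qb_5tg-qb_5^2+qb_5^2fg}{f-b_5qt}.$$ Then the variables $f,g$ satisfy the first-order $q$-difference equation $$(f\hat g-1)(fg-1)=qt^2\,\frac{(f-b_1)(f-b_2)(f-b_3)(f-b_4)}{(f-b_5qt)(f-b_5^{-1}t)},$$ where $f=f(t)$, $g=g(t)$, $\hat g=g(qt)$.
   Context: Fix $q$ with $0<|q|<1$, $(a;q)_\infty=\prod_{j\ge0}(1-aq^j)$, $(a_1,\dots,a_m;q)_\infty=\prod_i(a_i;q)_\infty$. Let $b_1,b_2,b_3,b_4,b_6$ be nonzero complex parameters with $b_1b_2b_3b_4=1$, and let $t\ne0$ be the deformation variable. A hat denotes $t\mapsto qt$, a check denotes $t\mapsto q^{-1}t$; hypotheses such as $g\ne0$ are understood at every point of the lattice $tq^{\mathbb Z}$ that is involved. The weight is $$w(x;t)=\frac{(b_2x,b_3x,b_6^{-1}xt^{-1};q)_\infty}{(b_1x,b_4x,b_6xt^{-1};q)_\infty}.$$ Put $$D_+(x;t)=b_6(1-b_1x)(1-b_4x)(t-b_6x),\qquad D_-(x;t)=(1-b_2x)(1-b_3x)(b_6t-x),$$ $$E_+(x;t)=b_6^{-1}(b_6qt-x),\qquad E_-(x;t)=qt-b_6x,$$ so that $w(qx;t)/w(x;t)=D_+/D_-$ and $w(x;qt)/w(x;t)=E_+/E_-$.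 Orthogonality is with respect to a Thomae–Jackson $q$-integral $\int_G$ in $x$ whose terminals coincide with zeros/poles of the weight, so that boundary terms vanish. Concretely, the Stieltjes function $\phi(x;t)=\int_G \frac{w(y;t)}{x-y}$ satisfies $D_-(x;t)\phi(qx;t)=D_+(x;t)\phi(x;t)+(q-1)x\,U(x;t)$ and $E_-(x;t)\phi(x;qt)=E_+(x;t)\phi(x;t)+(q-1)t\,T(x;t)$ with $U,T$ polynomial in $x$. The orthonormal polynomials $p_n(x;t)=\gamma_nx^n+\cdots$ ($\int_G w\,p_np_m=\delta_{nm}$, $\gamma_n=\gamma_n(t)\ne0$) are assumed to exist for all $n\ge0$; $a_n=\gamma_{n-1}/\gamma_n$ for $n\ge1$ is the off-diagonal coefficient of the three-term recurrence, and $a_0$ is an arbitrary nonzero quantity. Functions of the second kind: $q_n(x;t)=\int_G \frac{w(y;t)p_n(y;t)}{x-y}$ for $n\ge0$, with $p_{-1}=0$, $q_{-1}=1/(a_0\gamma_0)$. Set $$Y_n(x;t)=\begin{pmatrix}p_n & q_n/w\\ p_{n-1}& q_{n-1}/w\end{pmatrix}.$$ The spectral matrix $A_n^*$ is the matrix, polynomial in $x$, defined by $D_+(x;t)\,Y_n(qx;t)=A_n^*(x;t)\,Y_n(x;t)$, with entries written $$A_n^*=\begin{pmatrix}\mathfrak W_+&-\mathfrak T_+\\ \mathfrak T_-&\mathfrak W_-\end{pmatrix}.$$ Fix $n\in\mathbb Z_{\ge0}$ and put $b_5=b_1b_4b_6q^n$. Then $\mathfrak T_+$ is $x$ times a polynomial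 of degree one in $x$; $g(t)$ (also written $\lambda_n(t)$) denotes the zero of that degree-one polynomial. The variable $f$ is defined by $$\mathfrak W_+(g(t);t)=-\frac1t\,(g(t)-b_6t)(b_6g(t)-t)\,\big(f(q^{-1}t)\,g(t)-1\big),$$ where throughout it is assumed that $g(t)\ne 0,\,b_6t,\,b_6^{-1}t$ so that $f$ is well defined. *)

theory Defs
  imports "HOL-Analysis.Analysis" "HOL-Computational_Algebra.Polynomial"
begin

definition qpoch :: "complex \<Rightarrow> complex \<Rightarrow> complex" where
  "qpoch a q = prodinf (\<lambda>j. 1 - a * q ^ j)"

(* The weight has the value 0 at its poles (division by zero), so weight ... x \<noteq> 0 says that
   x is neither a zero nor a pole. *)
definition weight ::
  "complex \<Rightarrow> complex \<Rightarrow> complex \<Rightarrow> complex \<Rightarrow> complex \<Rightarrow> complex \<Rightarrow> complex \<Rightarrow> complex \<Rightarrow> complex"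
where
  "weight q b1 b2 b3 b4 b6 t x =
     (qpoch (b2 * x) q * qpoch (b3 * x) q * qpoch (x / (b6 * t)) q) /
     (qpoch (b1 * x) q * qpoch (b4 * x) q * qpoch (b6 * x / t) q)"

definition D_plus :: "complex \<Rightarrow> complex \<Rightarrow> complex \<Rightarrow> complex \<Rightarrow> complex \<Rightarrow> complex" where
  "D_plus b1 b4 b6 t x = b6 * (1 - b1 * x) * (1 - b4 * x) * (t - b6 * x)"

definition D_minus :: "complex \<Rightarrow> complex \<Rightarrow> complex \<Rightarrow> complex \<Rightarrow> complex \<Rightarrow> complex" where
  "D_minus b2 b3 b6 t x = (1 - b2 * x) * (1 - b3 * x) * (b6 * t - x)"

definition E_plus :: "complex \<Rightarrow> complex \<Rightarrow> complex \<Rightarrow> complex \<Rightarrow> complex" where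
  "E_plus q b6 t x = (b6 * q * t - x) / b6"

definition E_minus :: "complex \<Rightarrow> complex \<Rightarrow> complex \<Rightarrow> complex \<Rightarrow> complex" where
  "E_minus q b6 t x = q * t - b6 * x"

(* Thomae-Jackson q-integral with terminals \<alpha>, \<beta>: the difference of the sums
   (1 - q) c (\<Sum>k. h (c q^k) q^k) for c = \<beta> and c = \<alpha>. *)
definition jackson0 :: "complex \<Rightarrow> complex \<Rightarrow> (complex \<Rightarrow> complex) \<Rightarrow> complex" where
  "jackson0 q c h = (1 - q) * c * (\<Sum>k. h (c * q ^ k) * q ^ k)"

definition jackson :: "complex \<Rightarrow> complex \<Rightarrow> complex \<Rightarrow> (complex \<Rightarrow> complex) \<Rightarrow> complex" where
  "jackson q \<alpha> \<beta> h = jackson0 q \<beta> h - jackson0 q \<alpha> h"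

(* Points x at which the kernel 1/(x - y) is finite on the closure of the set of nodes y of
   the q-integral; 0 is the accumulation point of the nodes. *)
definition off_nodes :: "complex \<Rightarrow> complex \<Rightarrow> complex \<Rightarrow> complex \<Rightarrow> bool" where
  "off_nodes q \<alpha> \<beta> x \<longleftrightarrow> x \<noteq> 0 \<and> (\<forall>k::nat. x \<noteq> \<alpha> * q ^ k \<and> x \<noteq> \<beta> * q ^ k)"

definition stieltjes ::
  "complex \<Rightarrow> complex \<Rightarrow> complex \<Rightarrow> (complex \<Rightarrow> complex) \<Rightarrow> complex \<Rightarrow> complex"
where
  "stieltjes q \<alpha> \<beta> w x = jackson q \<alpha> \<beta> (\<lambda>y. w y / (x - y))"

definition x_equation ::
  "complex \<Rightarrow> complex \<Rightarrow> complex \<Rightarrow> (complex \<Rightarrow> complex) \<Rightarrow> (complex \<Rightarrow> complex) \<Rightarrow>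
   (complex \<Rightarrow> complex) \<Rightarrow> bool"
where
  "x_equation q \<alpha> \<beta> w Dp Dm \<longleftrightarrow>
     (\<exists>U :: complex poly. \<forall>x. off_nodes q \<alpha> \<beta> x \<and> off_nodes q \<alpha> \<beta> (q * x) \<longrightarrow>
        Dm x * stieltjes q \<alpha> \<beta> w (q * x) =
        Dp x * stieltjes q \<alpha> \<beta> w x + (q - 1) * x * poly U x)"

(* \<alpha>, \<beta>, w belong to the point t and \<alpha>', \<beta>', w' to the point q t. *)
definition t_equation ::
  "complex \<Rightarrow> complex \<Rightarrow> complex \<Rightarrow> complex \<Rightarrow> (complex \<Rightarrow> complex) \<Rightarrow>
   complex \<Rightarrow> complex \<Rightarrow> (complex \<Rightarrow> complex) \<Rightarrow>
   (complex \<Rightarrow> complex) \<Rightarrow> (complex \<Rightarrow> complex) \<Rightarrow> bool"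
where
  "t_equation q t \<alpha> \<beta> w \<alpha>' \<beta>' w' Ep Em \<longleftrightarrow>
     (\<exists>T :: complex poly. \<forall>x. off_nodes q \<alpha> \<beta> x \<and> off_nodes q \<alpha>' \<beta>' x \<longrightarrow>
        Em x * stieltjes q \<alpha>' \<beta>' w' x =
        Ep x * stieltjes q \<alpha> \<beta> w x + (q - 1) * t * poly T x)"

(* Orthonormality is with respect to a bilinear form: there is no complex conjugation. *)
definition orthonormal_polys ::
  "complex \<Rightarrow> complex \<Rightarrow> complex \<Rightarrow> (complex \<Rightarrow> complex) \<Rightarrow> (nat \<Rightarrow> complex poly) \<Rightarrow> bool"
where
  "orthonormal_polys q \<alpha> \<beta> w p \<longleftrightarrow>
     (\<forall>n. degree (p n) = n) \<and>
     (\<forall>n m. jackson q \<alpha> \<beta> (\<lambda>y. w y * poly (p n) y * poly (p m) y) = (if n = m then 1 else 0))"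

definition rec_coeff :: "complex \<Rightarrow> (nat \<Rightarrow> complex poly) \<Rightarrow> nat \<Rightarrow> complex" where
  "rec_coeff a0 p n = (if n = 0 then a0 else lead_coeff (p (n - 1)) / lead_coeff (p n))"

definition second_kind ::
  "complex \<Rightarrow> complex \<Rightarrow> complex \<Rightarrow> (complex \<Rightarrow> complex) \<Rightarrow> complex poly \<Rightarrow> complex \<Rightarrow> complex"
where
  "second_kind q \<alpha> \<beta> w r x = jackson q \<alpha> \<beta> (\<lambda>y. w y * poly r y / (x - y))"

definition Y_matrix ::
  "complex \<Rightarrow> complex \<Rightarrow> complex \<Rightarrow> (complex \<Rightarrow> complex) \<Rightarrow> complex \<Rightarrow> (nat \<Rightarrow> complex poly) \<Rightarrow>
   nat \<Rightarrow> complex \<Rightarrow> complex^2^2"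
where
  "Y_matrix q \<alpha> \<beta> w a0 p n x =
     vector [
       vector [poly (p n) x, second_kind q \<alpha> \<beta> w (p n) x / w x],
       vector [if n = 0 then 0 else poly (p (n - 1)) x,
               (if n = 0 then 1 / (a0 * lead_coeff (p 0))
                else second_kind q \<alpha> \<beta> w (p (n - 1)) x) / w x]]"

(* Wp, Tp, Tm, Wm are the (polynomial) entries of A, with the sign of Tp as displayed. *)
definition spectral_matrix ::
  "complex \<Rightarrow> complex \<Rightarrow> complex \<Rightarrow> (complex \<Rightarrow> complex) \<Rightarrow> (complex \<Rightarrow> complex) \<Rightarrow>
   complex \<Rightarrow> (nat \<Rightarrow> complex poly) \<Rightarrow> nat \<Rightarrow>
   complex poly \<Rightarrow> complex poly \<Rightarrow> complex poly \<Rightarrow> complex poly \<Rightarrow> bool"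
where
  "spectral_matrix q \<alpha> \<beta> w Dp a0 p n Wp Tp Tm Wm \<longleftrightarrow>
     (\<forall>x. off_nodes q \<alpha> \<beta> x \<and> off_nodes q \<alpha> \<beta> (q * x) \<and> w x \<noteq> 0 \<and> w (q * x) \<noteq> 0 \<longrightarrow>
        mat (Dp x) ** Y_matrix q \<alpha> \<beta> w a0 p n (q * x) =
        vector [vector [poly Wp x, - poly Tp x],
                vector [poly Tm x, poly Wm x]] ** Y_matrix q \<alpha> \<beta> w a0 p n x)"

end

theory Submission
  imports Defs
begin

text \<open>Write \<open>Q = P \<phi> - R\<close> for the function of the second kind of \<open>P\<close>, where \<open>\<phi>\<close> is the Stieltjes
  function and \<open>R\<close> a polynomial, and let \<open>Y\<close> be the matrix with rows \<open>(P, Q)\<close>. Besides the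
  spectral matrix, \<open>Y(qx;t) diag(D_+, D_-) = A(x) Y(x;t)\<close>, and the deformation matrix,
  \<open>Y(x;qt) diag(E_+, E_-) = B(x) Y(x;t)\<close>, we use the diagonal shift
  \<open>Y(qx;qt) diag((1 - b1 x)(1 - b4 x), (1 - b2 x)(1 - b3 x)) = N(x) Y(x;t)\<close>. It exists because
  \<open>w(x;t) / w(qx;qt)\<close> has no factor depending on \<open>t\<close>; that \<open>N\<close> is polynomial, also for special
  values of \<open>b6\<close>, follows since the Stieltjes functions have no poles at \<open>x = b6 t\<close> and
  \<open>x = t / b6\<close>, where the weight vanishes. Then
  \<open>B(qx) A(x;t) = q (b6 t - x)(t - b6 x) N(x)\<close> and
  \<open>A(x;qt) B(x) = (qt - b6 x)(b6 qt - x) N(x)\<close>, where \<open>B\<close> is linear and \<open>N\<close> quadratic, with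
  diagonal leading terms and \<open>N(0) = B(0) / (qt)\<close>. The second identity at \<open>x = g(qt)\<close>, where
  \<open>A(x;qt)\<close> is lower triangular, fixes the first row of \<open>N\<close> and gives
  \<open>N12(x) = N12(0) (1 - f x)\<close>; the first one at \<open>x = g(t)\<close> fixes \<open>N22\<close>. At \<open>x = 1 / f\<close> the
  determinant of \<open>N\<close>, a constant times \<open>\<Prod>(1 - b_i x)\<close>, is \<open>N11 N22\<close>, whose factors are
  proportional to \<open>(f - b5 q t)(f g(qt) - 1)\<close> and \<open>(f - t / b5)(f g(t) - 1)\<close>.\<close>

subsection \<open>The weight\<close>

lemma convergent_prod_qpoch:
  assumes "norm q < 1"
  shows "convergent_prod (\<lambda>j. 1 - a * q ^ j :: complex)"
proof (intro abs_convergent_prod_imp_convergent_prod summable_imp_abs_convergent_prod)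
  have "summable (\<lambda>j. norm a * norm q ^ j)"
    using assms by (intro summable_mult summable_geometric) simp
  then show "summable (\<lambda>j. norm (1 - a * q ^ j - 1))"
    by (simp add: norm_mult norm_power)
qed

lemma qpoch_split:
  assumes "norm q < 1"
  shows "qpoch a q = (\<Prod>j<k. 1 - a * q ^ j) * qpoch (a * q ^ k) q"
proof -
  have "(\<lambda>j. 1 - a * q ^ j) has_prod ((\<Prod>j<k. 1 - a * q ^ j) * (\<Prod>j. 1 - a * q ^ (j + k)))"
    by (rule has_prod_ignore_initial_segment'[OF convergent_prod_qpoch[OF assms]])
  then show ?thesis
    unfolding qpoch_def by (simp add: has_prod_iff power_add mult_ac)
qed

lemma qpoch_step:
  assumes "norm q < 1"
  shows "qpoch a q = (1 - a) * qpoch (q * a) q"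
  using qpoch_split[OF assms, of a 1] by (simp add: mult.commute)

text \<open>A convergent infinite product vanishes only through one of its factors.\<close>

lemma qpoch_eq_0_iff:
  assumes "norm q < 1"
  shows "qpoch a q = 0 \<longleftrightarrow> (\<exists>j. a * q ^ j = 1)"
proof
  assume "\<exists>j. a * q ^ j = 1"
  then obtain j where "a * q ^ j = 1" ..
  then show "qpoch a q = 0"
    using qpoch_split[OF assms, of a "Suc j"] by simp
next
  assume *: "qpoch a q = 0"
  show "\<exists>j. a * q ^ j = 1"
  proof (rule ccontr)
    assume "\<not> ?thesis"
    then have "1 - a * q ^ j \<noteq> 0" for j by (metis eq_iff_diff_eq_0)
    then show False
      using prodinf_nonzero[OF convergent_prod_qpoch[OF assms]] * unfolding qpoch_def by blast
  qed
qed

text \<open>Size bound for the exceptional set of later polynomial comparisons. For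
  \<open>c = 0\<close> there are no zeros at all, so the inclusion in the proof covers this case
  too.\<close>

lemma countable_qpoch_zeros:
  assumes "norm q < 1"
  shows "countable {x. qpoch (c * x) q = 0}"
proof -
  have "{x. qpoch (c * x) q = 0} \<subseteq> range (\<lambda>j. 1 / (c * q ^ j))"
  proof
    fix x assume "x \<in> {x. qpoch (c * x) q = 0}"
    then obtain j where "c * x * q ^ j = 1"
      using qpoch_eq_0_iff[OF assms] by auto
    then have "x * (c * q ^ j) = 1" by (simp add: mult_ac)
    then have "x = 1 / (c * q ^ j)"
      by (metis nonzero_eq_divide_eq mult_zero_right zero_neq_one)
    then show "x \<in> range (\<lambda>j. 1 / (c * q ^ j))" by blast
  qed
  then show ?thesis by (rule countable_subset) simp
qed

lemma geometric_tendsto_0: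
  fixes c q :: complex
  assumes "norm q < 1"
  shows "(\<lambda>k. c * q ^ k) \<longlonglongrightarrow> 0"
  using tendsto_mult_left[OF LIMSEQ_power_zero[OF assms], of c] by simp

text \<open>The tail of the product is the full product divided by its partial products. Since the
  product for \<open>c\<close> may itself be 0, the division starts at an index \<open>m\<close>
  with \<open>norm (c * q ^ m) < 1\<close>, beyond which no factor vanishes.\<close>

lemma qpoch_tendsto_1:
  assumes "norm q < 1"
  shows "(\<lambda>k. qpoch (c * q ^ k) q) \<longlonglongrightarrow> 1"
proof -
  have "eventually (\<lambda>k. norm (c * q ^ k) < 1) sequentially"
    using order_tendstoD(2)[OF tendsto_norm[OF geometric_tendsto_0[OF assms]], of 1 c] by simp
  then obtain m where m: "norm (c * q ^ m) < 1"
    by (auto simp: eventually_sequentially)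
  define a where "a = c * q ^ m"
  have nz: "qpoch a q \<noteq> 0"
  proof
    assume "qpoch a q = 0"
    then obtain j where "a * q ^ j = 1" using qpoch_eq_0_iff[OF assms] by auto
    moreover have "norm (a * q ^ j) < 1"
    proof -
      have "norm (a * q ^ j) \<le> norm a * 1"
        unfolding norm_mult norm_power
        using assms by (intro mult_left_mono power_le_one) auto
      then show ?thesis using m by (simp add: a_def)
    qed
    ultimately show False by simp
  qed
  have "(\<lambda>k. \<Prod>j<k. 1 - a * q ^ j) \<longlonglongrightarrow> qpoch a q"
    unfolding qpoch_def using convergent_prod_qpoch[OF assms]
    by (intro has_prod_imp_tendsto') (simp add: convergent_prod_has_prod_iff)
  then have "(\<lambda>k. qpoch a q / (\<Prod>j<k. 1 - a * q ^ j)) \<longlonglongrightarrow> qpoch a q / qpoch a q"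
    using nz by (intro tendsto_intros)
  moreover have "qpoch a q / (\<Prod>j<k. 1 - a * q ^ j) = qpoch (c * q ^ (k + m)) q" for k
    using qpoch_split[OF assms, of a k] nz
    by (auto simp: a_def power_add mult_ac)
  ultimately have "(\<lambda>k. qpoch (c * q ^ (k + m)) q) \<longlonglongrightarrow> 1"
    using nz by simp
  then show ?thesis by (rule LIMSEQ_offset)
qed

text \<open>Supplies the boundedness of the weight along each node sequence, and with it the
  convergence of the Jackson sums.\<close>

lemma weight_tendsto_1:
  assumes "norm q < 1"
  shows "(\<lambda>k. weight q b1 b2 b3 b4 b6 t (c * q ^ k)) \<longlonglongrightarrow> 1"
proof -
  have lim: "(\<lambda>k. qpoch (b * (c * q ^ k)) q) \<longlonglongrightarrow> 1" for b
    using qpoch_tendsto_1[OF assms, of "b * c"] by (simp add: mult.assoc)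
  have "(\<lambda>k. weight q b1 b2 b3 b4 b6 t (c * q ^ k)) \<longlonglongrightarrow> (1 * 1 * 1) / (1 * 1 * 1)"
    unfolding weight_def
    using lim[of b2] lim[of b3] lim[of "1 / (b6 * t)"] lim[of b1] lim[of b4] lim[of "b6 / t"]
    by (intro tendsto_intros) auto
  then show ?thesis by simp
qed

lemma countable_weight_zeros:
  assumes "norm q < 1"
  shows "countable {x. weight q b1 b2 b3 b4 b6 t x = 0}"
proof -
  let ?Z = "\<lambda>c. {x. qpoch (c * x) q = 0}"
  have "{x. weight q b1 b2 b3 b4 b6 t x = 0} \<subseteq>
      ?Z b1 \<union> ?Z b2 \<union> ?Z b3 \<union> ?Z b4 \<union> ?Z (1 / (b6 * t)) \<union> ?Z (b6 / t)"
    by (auto simp: weight_def)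
  then show ?thesis
    by (rule countable_subset) (intro countable_Un countable_qpoch_zeros assms)
qed

text \<open>Each q-product sheds one factor under \<open>x \<mapsto> q * x\<close>. A nonzero weight
  at \<open>x\<close> keeps the shed denominator factors nonzero, so that they cancel even though
  the weight is set to 0 at its poles.\<close>

lemma weight_q_shift:
  assumes "norm q < 1" "b6 \<noteq> 0" "t \<noteq> 0" "weight q b1 b2 b3 b4 b6 t x \<noteq> 0"
  shows "D_minus b2 b3 b6 t x * weight q b1 b2 b3 b4 b6 t (q * x) =
    D_plus b1 b4 b6 t x * weight q b1 b2 b3 b4 b6 t x"
proof -
  have step: "qpoch (b * x) q = (1 - b * x) * qpoch (b * (q * x)) q" for b
    using qpoch_step[OF assms(1), of "b * x"] by (simp add: mult_ac)
  have step': "qpoch (x / (b6 * t)) q = (1 - x / (b6 * t)) * qpoch (q * x / (b6 * t)) q"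
    "qpoch (b6 * x / t) q = (1 - b6 * x / t) * qpoch (b6 * (q * x) / t) q"
    using step[of "1 / (b6 * t)"] step[of "b6 / t"] by simp_all
  define A where "A = qpoch (b2 * (q * x)) q * qpoch (b3 * (q * x)) q * qpoch (q * x / (b6 * t)) q"
  define B where "B = qpoch (b1 * (q * x)) q * qpoch (b4 * (q * x)) q * qpoch (b6 * (q * x) / t) q"
  have w: "weight q b1 b2 b3 b4 b6 t (q * x) = A / B"
    "weight q b1 b2 b3 b4 b6 t x =
      ((1 - b2 * x) * (1 - b3 * x) * (1 - x / (b6 * t)) * A) /
      ((1 - b1 * x) * (1 - b4 * x) * (1 - b6 * x / t) * B)"
    unfolding weight_def step[of b1] step[of b2] step[of b3] step[of b4] step' A_def B_def
    by (simp_all add: mult_ac)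
  have "1 - b1 * x \<noteq> 0" "1 - b4 * x \<noteq> 0" "1 - b6 * x / t \<noteq> 0" "B \<noteq> 0"
    using assms(4) unfolding w by auto
  moreover have D: "D_plus b1 b4 b6 t x = b6 * t * ((1 - b1 * x) * (1 - b4 * x) * (1 - b6 * x / t))"
    "D_minus b2 b3 b6 t x = b6 * t * ((1 - b2 * x) * (1 - b3 * x) * (1 - x / (b6 * t)))"
    using assms(2,3) by (simp_all add: D_plus_def D_minus_def field_simps)
  moreover have "k * m * (A / B) = k * p * (m * A / (p * B))" if "p \<noteq> 0" for k m p :: complex
    using that by simp
  ultimately show ?thesis
    unfolding w D by (metis mult_eq_0_iff)
qed

text \<open>At \<open>x = t / b6\<close> the denominator contains \<open>qpoch 1 q = 0\<close>, and
  division by zero gives the value 0; at \<open>x = b6 * t\<close> the same factor stands in the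
  numerator.\<close>

lemma weight_eq_0:
  assumes "norm q < 1" "b6 * x = t \<or> x = b6 * t" "b6 \<noteq> 0" "t \<noteq> 0"
  shows "weight q b1 b2 b3 b4 b6 t x = 0"
proof -
  have "qpoch 1 q = 0"
    using qpoch_eq_0_iff[OF assms(1), of 1] by (metis mult_1 power_0)
  then show ?thesis
    using assms by (auto simp: weight_def)
qed

subsection \<open>Jackson integrals and Stieltjes functions\<close>

lemma Bseq_tendsto: "X \<longlonglongrightarrow> (l :: complex) \<Longrightarrow> Bseq X"
  by (rule convergent_imp_Bseq) (auto simp: convergent_def)

lemma Bseq_mult_complex:
  fixes X Y :: "nat \<Rightarrow> complex"
  assumes "Bseq X" "Bseq Y"
  shows "Bseq (\<lambda>k. X k * Y k)"
proof -
  obtain K L where "K > 0" "\<And>k. norm (X k) \<le> K" "L > 0" "\<And>k. norm (Y k) \<le> L"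
    using assms by (auto simp: Bseq_def)
  then have "norm (X k * Y k) \<le> K * L" for k
    by (simp add: norm_mult mult_mono')
  then show ?thesis by (rule BseqI')
qed

lemma summable_jackson0:
  fixes q c :: complex
  assumes "norm q < 1" "Bseq (\<lambda>k. h (c * q ^ k))"
  shows "summable (\<lambda>k. h (c * q ^ k) * q ^ k)"
proof -
  obtain M where M: "\<And>k. norm (h (c * q ^ k)) \<le> M"
    using assms(2) by (auto simp: Bseq_def)
  show ?thesis
  proof (rule summable_comparison_test')
    show "summable (\<lambda>k. M * norm q ^ k)"
      using assms(1) by (intro summable_mult summable_geometric) simp
    show "norm (h (c * q ^ k) * q ^ k) \<le> M * norm q ^ k" for k
      unfolding norm_mult norm_power using M by (intro mult_right_mono) auto
  qed
qed

lemma norm_jackson0_le: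
  fixes q c :: complex
  assumes "norm q < 1" "\<And>k. norm (h (c * q ^ k)) \<le> M"
  shows "norm (jackson0 q c h) \<le> norm ((1 - q) * c) * (M / (1 - norm q))"
proof -
  have "norm (\<Sum>k. h (c * q ^ k) * q ^ k) \<le> (\<Sum>k. M * norm q ^ k)"
  proof (rule norm_suminf_le)
    show "summable (\<lambda>k. M * norm q ^ k)"
      using assms(1) by (intro summable_mult summable_geometric) simp
    show "norm (h (c * q ^ k) * q ^ k) \<le> M * norm q ^ k" for k
      unfolding norm_mult norm_power using assms(2) by (intro mult_right_mono) auto
  qed
  also have "\<dots> = M / (1 - norm q)"
    using assms(1) by (simp add: suminf_mult suminf_geometric summable_geometric)
  finally show ?thesis
    unfolding jackson0_def norm_mult by (intro mult_left_mono) auto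
qed

text \<open>Abstracts from the explicit weight: boundedness on the two node sequences makes the sums
  converge against the factor \<open>q ^ k\<close>. The locale is instantiated at \<open>t\<close>
  and at \<open>q * t\<close>.\<close>

locale jackson_weight =
  fixes q \<alpha> \<beta> :: complex and w :: "complex \<Rightarrow> complex"
  assumes norm_q: "norm q < 1"
    and Bseq_w: "c \<in> {\<alpha>, \<beta>} \<Longrightarrow> Bseq (\<lambda>k. w (c * q ^ k))"
begin

definition node_bounded :: "(complex \<Rightarrow> complex) \<Rightarrow> bool" where
  "node_bounded h \<longleftrightarrow> (\<forall>c\<in>{\<alpha>, \<beta>}. Bseq (\<lambda>k. h (c * q ^ k)))"

definition moment :: "complex poly \<Rightarrow> complex" where
  "moment r = jackson q \<alpha> \<beta> (\<lambda>y. w y * poly r y)"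

abbreviation "off \<equiv> off_nodes q \<alpha> \<beta>"
abbreviation "stj \<equiv> stieltjes q \<alpha> \<beta> w"
abbreviation "skind \<equiv> second_kind q \<alpha> \<beta> w"

lemma jackson_add:
  assumes "node_bounded h" "node_bounded h'"
  shows "jackson q \<alpha> \<beta> (\<lambda>y. h y + h' y) = jackson q \<alpha> \<beta> h + jackson q \<alpha> \<beta> h'"
proof -
  have "jackson0 q c (\<lambda>y. h y + h' y) = jackson0 q c h + jackson0 q c h'" if "c \<in> {\<alpha>, \<beta>}" for c
  proof -
    have "summable (\<lambda>k. h (c * q ^ k) * q ^ k)" "summable (\<lambda>k. h' (c * q ^ k) * q ^ k)"
      using assms that norm_q by (auto simp: node_bounded_def intro!: summable_jackson0)
    then show ?thesis
      by (simp add: jackson0_def distrib_right suminf_add[symmetric] distrib_left)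
  qed
  then show ?thesis by (simp add: jackson_def)
qed

lemma jackson_cmult:
  assumes "node_bounded h"
  shows "jackson q \<alpha> \<beta> (\<lambda>y. a * h y) = a * jackson q \<alpha> \<beta> h"
  using assms suminf_mult[OF summable_jackson0[OF norm_q], of h _ a]
  by (simp add: jackson_def jackson0_def node_bounded_def algebra_simps)

lemma jackson_cong:
  assumes "\<And>c k. c \<in> {\<alpha>, \<beta>} \<Longrightarrow> h (c * q ^ k) = h' (c * q ^ k)"
  shows "jackson q \<alpha> \<beta> h = jackson q \<alpha> \<beta> h'"
  using assms by (simp add: jackson_def jackson0_def)

lemma node_bounded_add:
  assumes "node_bounded h" "node_bounded h'"
  shows "node_bounded (\<lambda>y. h y + h' y)"
  unfolding node_bounded_def
proof
  fix c assume "c \<in> {\<alpha>, \<beta>}"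
  then obtain K L where "\<And>k. norm (h (c * q ^ k)) \<le> K" "\<And>k. norm (h' (c * q ^ k)) \<le> L"
    using assms unfolding node_bounded_def Bseq_def by meson
  then have "norm (h (c * q ^ k) + h' (c * q ^ k)) \<le> K + L" for k
    by (meson add_mono norm_triangle_le)
  then show "Bseq (\<lambda>k. h (c * q ^ k) + h' (c * q ^ k))" by (rule BseqI')
qed

lemma node_bounded_cmult: "node_bounded h \<Longrightarrow> node_bounded (\<lambda>y. a * h y)"
  unfolding node_bounded_def by (auto intro!: Bseq_mult_complex[OF Bseq_tendsto[OF tendsto_const]])

lemma node_bounded_poly: "node_bounded (\<lambda>y. w y * poly r y)"
  unfolding node_bounded_def
proof
  fix c assume "c \<in> {\<alpha>, \<beta>}"
  have "(\<lambda>k. poly r (c * q ^ k)) \<longlonglongrightarrow> poly r 0"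
    by (intro tendsto_intros geometric_tendsto_0 norm_q)
  then show "Bseq (\<lambda>k. w (c * q ^ k) * poly r (c * q ^ k))"
    using Bseq_w[OF \<open>c \<in> {\<alpha>, \<beta>}\<close>] by (intro Bseq_mult_complex[OF _ Bseq_tendsto])
qed

lemma node_bounded_kernel:
  assumes "off x"
  shows "node_bounded (\<lambda>y. w y * poly r y / (x - y))"
  unfolding node_bounded_def
proof
  fix c assume c: "c \<in> {\<alpha>, \<beta>}"
  have "(\<lambda>k. 1 / (x - c * q ^ k)) \<longlonglongrightarrow> 1 / (x - 0)"
    using assms by (intro tendsto_intros geometric_tendsto_0 norm_q) (simp add: off_nodes_def)
  then have "Bseq (\<lambda>k. 1 / (x - c * q ^ k))" by (rule Bseq_tendsto)
  moreover have "Bseq (\<lambda>k. w (c * q ^ k) * poly r (c * q ^ k))"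
    using node_bounded_poly[of r] c unfolding node_bounded_def by blast
  ultimately have "Bseq (\<lambda>k. w (c * q ^ k) * poly r (c * q ^ k) * (1 / (x - c * q ^ k)))"
    by (rule Bseq_mult_complex[rotated])
  then show "Bseq (\<lambda>k. w (c * q ^ k) * poly r (c * q ^ k) / (x - c * q ^ k))" by simp
qed

section \<open>Moments and functions of the second kind\<close>

lemma moment_add: "moment (r + s) = moment r + moment s"
  unfolding moment_def by (simp add: algebra_simps jackson_add node_bounded_poly)

lemma moment_smult: "moment (smult a r) = a * moment r"
  using jackson_cmult[OF node_bounded_poly, of a r]
  unfolding moment_def by (simp add: mult_ac)

lemma moment_diff: "moment (r - s) = moment r - moment s"
  using moment_add[of r "smult (-1) s"] moment_smult[of "-1" s] by simp

text \<open>From \<open>y / (x - y) = x / (x - y) - 1\<close>: a factor \<open>y\<close> under the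
  integral becomes a factor \<open>x\<close> outside, at the price of a moment.\<close>

lemma skind_pCons:
  assumes "off x"
  shows "skind (pCons a r) x = a * stj x + x * skind r x - moment r"
proof -
  have bd: "node_bounded (\<lambda>y. a * (w y / (x - y)))"
    "node_bounded (\<lambda>y. x * (w y * poly r y / (x - y)))" "node_bounded (\<lambda>y. (-1) * (w y * poly r y))"
    using node_bounded_kernel[OF assms, of 1]
    by (simp_all only: node_bounded_cmult node_bounded_kernel[OF assms] node_bounded_poly
        poly_1 mult_1_right)
  have "skind (pCons a r) x = jackson q \<alpha> \<beta> (\<lambda>y. (a * (w y / (x - y)) +
      x * (w y * poly r y / (x - y))) + (-1) * (w y * poly r y))"
    unfolding second_kind_def
  proof (rule jackson_cong)
    fix c k assume "c \<in> {\<alpha>, \<beta>}"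
    then have "x - c * q ^ k \<noteq> 0" using assms by (auto simp: off_nodes_def)
    then show "w (c * q ^ k) * poly (pCons a r) (c * q ^ k) / (x - c * q ^ k) =
      (a * (w (c * q ^ k) / (x - c * q ^ k)) +
      x * (w (c * q ^ k) * poly r (c * q ^ k) / (x - c * q ^ k))) + (-1) * (w (c * q ^ k) * poly r (c * q ^ k))"
      by (simp add: divide_simps) (simp add: algebra_simps)
  qed
  also have "\<dots> = a * stj x + x * skind r x - moment r"
    unfolding jackson_add[OF node_bounded_add[OF bd(1,2)] bd(3)] jackson_add[OF bd(1,2)]
      jackson_cmult[OF node_bounded_kernel[OF assms, of 1, unfolded poly_1 mult_1_right]]
      jackson_cmult[OF node_bounded_kernel[OF assms]] jackson_cmult[OF node_bounded_poly]
    by (simp add: second_kind_def stieltjes_def moment_def)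
  finally show ?thesis .
qed

text \<open>Horner induction on the coefficients of \<open>r\<close>; \<open>R\<close> is the
  associated (numerator) polynomial, and each step prepends a moment to it.\<close>

lemma skind_numerator: "\<exists>R. \<forall>x. off x \<longrightarrow> skind r x = poly r x * stj x - poly R x"
proof (induction r)
  case 0
  have "skind 0 x = 0" for x
    by (simp add: second_kind_def jackson_def jackson0_def)
  then show ?case by (intro exI[of _ 0]) simp
next
  case (pCons a r)
  then obtain R where R: "\<And>x. off x \<Longrightarrow> skind r x = poly r x * stj x - poly R x"
    by blast
  show ?case
    by (intro exI[of _ "pCons (moment r) R"])
      (simp add: skind_pCons R algebra_simps)
qed

section \<open>Behaviour at infinity and near the nodes\<close>

lemma eventually_off_at_infinity: "eventually off at_infinity"
proof -
  have "off x" if "norm x \<ge> norm \<alpha> + norm \<beta> + 1" for x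
  proof -
    have "norm (c * q ^ k) \<le> norm c * 1" for c k
      unfolding norm_mult norm_power using norm_q by (intro mult_left_mono power_le_one) auto
    then show ?thesis using that norm_ge_zero[of \<alpha>] norm_ge_zero[of \<beta>]
      unfolding off_nodes_def
      by (smt (verit, best) mult_1_right norm_zero)
  qed
  then show ?thesis unfolding eventually_at_infinity by blast
qed

lemma countable_not_off: "countable {x. \<not> off x}"
proof -
  have "{x. \<not> off x} \<subseteq> {0} \<union> range (\<lambda>k. \<alpha> * q ^ k) \<union> range (\<lambda>k. \<beta> * q ^ k)"
    by (auto simp: off_nodes_def)
  then show ?thesis by (rule countable_subset) simp
qed

text \<open>Once \<open>norm x\<close> exceeds twice the norm of a terminal \<open>c\<close>, every
  node \<open>c * q ^ k\<close> has distance at least \<open>norm x / 2\<close> from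
  \<open>x\<close>, so the integrand is of order \<open>1 / norm x\<close> uniformly in
  \<open>k\<close>.\<close>

lemma skind_tendsto_0: "(skind r \<longlongrightarrow> 0) at_infinity"
proof -
  have "((\<lambda>x. jackson0 q c (\<lambda>y. w y * poly r y / (x - y))) \<longlongrightarrow> 0) at_infinity"
    if c: "c \<in> {\<alpha>, \<beta>}" for c
  proof -
    obtain M where "M > 0" and M: "\<And>k. norm (w (c * q ^ k) * poly r (c * q ^ k)) \<le> M"
      using node_bounded_poly c unfolding node_bounded_def Bseq_def by blast
    have "eventually (\<lambda>x. norm (jackson0 q c (\<lambda>y. w y * poly r y / (x - y))) \<le>
      norm ((1 - q) * c) * ((2 * M / norm x) / (1 - norm q))) at_infinity"
      unfolding eventually_at_infinity
    proof (intro exI allI impI norm_jackson0_le norm_q)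
      fix x :: complex and k assume x: "norm x \<ge> 2 * norm c + 1"
      have "norm (c * q ^ k) \<le> norm c * 1"
        unfolding norm_mult norm_power using norm_q by (intro mult_left_mono power_le_one) auto
      then have "norm (x - c * q ^ k) \<ge> norm x / 2" "norm x > 0"
        using x norm_triangle_ineq2[of x "c * q ^ k"] norm_ge_zero[of c] by linarith+
      then have "norm (w (c * q ^ k) * poly r (c * q ^ k)) / norm (x - c * q ^ k) \<le> M / (norm x / 2)"
        using M[of k] \<open>M > 0\<close> by (intro frac_le) auto
      then show "norm (w (c * q ^ k) * poly r (c * q ^ k) / (x - c * q ^ k)) \<le> 2 * M / norm x"
        by (simp add: norm_divide mult.commute)
    qed
    moreover have "((\<lambda>x::complex. norm ((1 - q) * c) * ((2 * M / norm x) / (1 - norm q))) \<longlongrightarrow> 0) at_infinity"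
    proof -
      have "((\<lambda>x::complex. inverse (norm x)) \<longlongrightarrow> 0) at_infinity"
        using tendsto_norm_zero[OF tendsto_inverse_0[where 'a=complex]] by (simp add: norm_inverse)
      from tendsto_mult_right_zero[OF this, of "norm ((1 - q) * c) * 2 * M / (1 - norm q)"]
      show ?thesis by (simp add: field_simps)
    qed
    ultimately show ?thesis by (rule Lim_null_comparison)
  qed
  from tendsto_diff[OF this[of \<beta>] this[of \<alpha>]] show ?thesis
    unfolding second_kind_def jackson_def by simp
qed

text \<open>The nodes accumulate only at 0, so all but finitely many stay at distance
  \<open>norm x0 / 2\<close> from \<open>x0\<close>; the rest contribute a finite minimum.\<close>

lemma nodes_isolated:
  assumes "x0 \<noteq> 0"
  obtains \<delta> where "\<delta> > 0"
    "\<And>c k. c \<in> {\<alpha>, \<beta>} \<Longrightarrow> c * q ^ k \<noteq> x0 \<Longrightarrow> norm (x0 - c * q ^ k) \<ge> \<delta>"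
proof -
  have one: "\<exists>\<delta>>0. \<forall>k. c * q ^ k \<noteq> x0 \<longrightarrow> norm (x0 - c * q ^ k) \<ge> \<delta>" for c
  proof -
    have "(\<lambda>k. norm (x0 - c * q ^ k)) \<longlonglongrightarrow> norm (x0 - 0)"
      by (intro tendsto_intros geometric_tendsto_0 norm_q)
    then have "eventually (\<lambda>k. norm (x0 - c * q ^ k) > norm x0 / 2) sequentially"
      using assms by (intro order_tendstoD(1)) auto
    then obtain N where N: "\<And>k. k \<ge> N \<Longrightarrow> norm (x0 - c * q ^ k) > norm x0 / 2"
      by (auto simp: eventually_sequentially)
    define D where "D = insert (norm x0 / 2) ((\<lambda>k. norm (x0 - c * q ^ k)) ` {k. k < N \<and> c * q ^ k \<noteq> x0})"
    have fin: "finite D" "D \<noteq> {}" by (auto simp: D_def)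
    have "Min D > 0"
      using assms fin by (subst Min_gr_iff) (auto simp: D_def)
    moreover have "norm (x0 - c * q ^ k) \<ge> Min D" if "c * q ^ k \<noteq> x0" for k
    proof (cases "k < N")
      case True
      then show ?thesis using that fin by (intro Min_le) (auto simp: D_def)
    next
      case False
      have "Min D \<le> norm x0 / 2" using fin by (intro Min_le) (auto simp: D_def)
      then show ?thesis using N[of k] False by simp
    qed
    ultimately show ?thesis by blast
  qed
  obtain d1 d2 where "d1 > 0" "d2 > 0"
    "\<And>k. \<alpha> * q ^ k \<noteq> x0 \<Longrightarrow> norm (x0 - \<alpha> * q ^ k) \<ge> d1"
    "\<And>k. \<beta> * q ^ k \<noteq> x0 \<Longrightarrow> norm (x0 - \<beta> * q ^ k) \<ge> d2"
    using one[of \<alpha>] one[of \<beta>] by blast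
  then show ?thesis
    by (intro that[of "min d1 d2"]) (auto simp: min_le_iff_disj)
qed

lemma eventually_off_at:
  assumes "x0 \<noteq> 0"
  shows "eventually off (at x0)"
proof -
  obtain \<delta> where \<delta>: "\<delta> > 0"
    "\<And>c k. c \<in> {\<alpha>, \<beta>} \<Longrightarrow> c * q ^ k \<noteq> x0 \<Longrightarrow> norm (x0 - c * q ^ k) \<ge> \<delta>"
    using nodes_isolated[OF assms] by blast
  have "off x" if "x \<noteq> x0" "dist x x0 < min \<delta> (norm x0)" for x
    using that \<delta>(2)[of \<alpha>] \<delta>(2)[of \<beta>]
    by (force simp: off_nodes_def dist_norm norm_minus_commute)
  then show ?thesis
    unfolding eventually_at using \<delta>(1) assms by (intro exI[of _ "min \<delta> (norm x0)"]) auto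
qed

text \<open>The Stieltjes function has at most simple poles at the nodes, and the residue at a node
  is proportional to the value of the weight there.\<close>

lemma stj_no_pole:
  assumes "x0 \<noteq> 0" "w x0 = 0"
  shows "((\<lambda>x. (x - x0) * stj x) \<longlongrightarrow> 0) (at x0)"
proof -
  obtain \<delta> where \<delta>: "\<delta> > 0"
    "\<And>c k. c \<in> {\<alpha>, \<beta>} \<Longrightarrow> c * q ^ k \<noteq> x0 \<Longrightarrow> norm (x0 - c * q ^ k) \<ge> \<delta>"
    using nodes_isolated[OF assms(1)] by blast
  have "((\<lambda>x. (x - x0) * jackson0 q c (\<lambda>y. w y / (x - y))) \<longlongrightarrow> 0) (at x0)"
    if c: "c \<in> {\<alpha>, \<beta>}" for c
  proof -
    obtain M where "M > 0" and M: "\<And>k. norm (w (c * q ^ k)) \<le> M"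
      using Bseq_w[OF c] unfolding Bseq_def by blast
    define K where "K = norm ((1 - q) * c) * (M / (\<delta> / 2) / (1 - norm q))"
    \<comment> \<open>A node at \<open>x0\<close> itself contributes 0 because the weight vanishes
      there; all other nodes are at distance at least \<open>\<delta> / 2\<close> from
      \<open>x\<close>. So the sum stays bounded near \<open>x0\<close>.\<close>
    have "norm (jackson0 q c (\<lambda>y. w y / (x - y))) \<le> K" if "dist x x0 < \<delta> / 2" for x
      unfolding K_def
    proof (intro norm_jackson0_le norm_q)
      fix k
      show "norm (w (c * q ^ k) / (x - c * q ^ k)) \<le> M / (\<delta> / 2)"
      proof (cases "c * q ^ k = x0")
        case True
        then show ?thesis using assms(2) \<open>M > 0\<close> \<delta>(1) by simp
      next
        case False
        then have "norm (x - c * q ^ k) \<ge> \<delta> / 2"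
          using \<delta>(2)[OF c False] that norm_triangle_ineq[of "x0 - x" "x - c * q ^ k"]
          by (simp add: dist_norm norm_minus_commute)
        then show ?thesis
          unfolding norm_divide using M[of k] \<delta>(1) \<open>M > 0\<close> by (intro frac_le) auto
      qed
    qed
    then have "eventually (\<lambda>x. norm ((x - x0) * jackson0 q c (\<lambda>y. w y / (x - y))) \<le> norm (x - x0) * K) (at x0)"
      unfolding eventually_at norm_mult using \<delta>(1)
      by (intro exI[of _ "\<delta> / 2"]) (auto intro: mult_left_mono)
    moreover have "((\<lambda>x. norm (x - x0) * K) \<longlongrightarrow> 0) (at x0)"
      by (auto intro!: tendsto_eq_intros)
    ultimately show ?thesis by (rule Lim_null_comparison)
  qed
  from tendsto_diff[OF this[of \<beta>] this[of \<alpha>]] show ?thesis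
    unfolding stieltjes_def jackson_def by (simp add: algebra_simps)
qed

end

subsection \<open>Transfer matrices\<close>

lemma poly_over_power_tendsto:
  fixes p :: "complex poly"
  assumes "degree p \<le> d"
  shows "((\<lambda>x. poly p x / x ^ d) \<longlongrightarrow> coeff p d) at_infinity"
proof (cases "degree p = d")
  case True
  then show ?thesis using poly_divide_tendsto_aux[of p] by simp
next
  case False
  then have "((\<lambda>x. poly p x / poly (monom 1 d) x) \<longlongrightarrow> 0) at_infinity"
    using assms by (intro poly_divide_tendsto_0_at_infinity) (simp add: degree_monom_eq)
  then show ?thesis
    using False assms by (simp add: poly_monom coeff_eq_0)
qed

lemma inverse_power_tendsto_0:
  assumes "k > 0"
  shows "((\<lambda>x::complex. 1 / x ^ k) \<longlongrightarrow> 0) at_infinity"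
  using assms by (intro tendsto_divide_0[OF tendsto_const] filterlim_power_at_infinity) simp

text \<open>If the degree exceeded \<open>d\<close>, a further division by a power of
  \<open>x\<close> would force the leading coefficient to be 0. Degrees and leading coefficients of
  the transfer matrices are read off from asymptotics in this way.\<close>

lemma poly_limit_imp_degree:
  fixes p :: "complex poly"
  assumes "((\<lambda>x. poly p x / x ^ d) \<longlongrightarrow> L) at_infinity"
  shows "degree p \<le> d" "coeff p d = L"
proof -
  show "degree p \<le> d"
  proof (rule ccontr)
    assume "\<not> ?thesis"
    then have d: "d < degree p" by simp
    have "((\<lambda>x. poly p x / x ^ d * (1 / x ^ (degree p - d))) \<longlongrightarrow> L * 0) at_infinity"
      using d by (intro tendsto_mult assms inverse_power_tendsto_0) simp
    moreover have "(\<lambda>x. poly p x / x ^ d * (1 / x ^ (degree p - d))) = (\<lambda>x. poly p x / x ^ degree p)"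
      using d by (simp add: fun_eq_iff flip: power_add)
    ultimately have "((\<lambda>x. poly p x / x ^ degree p) \<longlongrightarrow> 0) at_infinity" by (simp only: mult_zero_right)
    then have "lead_coeff p = 0"
      using tendsto_unique[OF trivial_limit_at_infinity poly_divide_tendsto_aux] by blast
    then show False using d by simp
  qed
  then show "coeff p d = L"
    using tendsto_unique[OF trivial_limit_at_infinity poly_over_power_tendsto assms] by blast
qed

text \<open>The identities are first known away from nodes and zeros of the weight. These sets may
  be infinite but are countable, whereas the complex plane is not.\<close>

lemma poly_eq_of_countable:
  fixes p r :: "complex poly"
  assumes "countable A" "\<And>x. x \<notin> A \<Longrightarrow> poly p x = poly r x"
  shows "p = r"
proof (rule ccontr)
  assume "p \<noteq> r"
  then have "finite {x. poly (p - r) x = 0}" by (intro poly_roots_finite) simp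
  moreover have "UNIV \<subseteq> {x. poly (p - r) x = 0} \<union> A" using assms(2) by auto
  ultimately have "countable (UNIV :: complex set)"
    using assms(1) by (meson countable_Un countable_finite countable_subset)
  then show False using uncountable_UNIV_complex by blast
qed

text \<open>\<open>P \<phi> - R\<close> and \<open>P' \<phi> - R'\<close> are the functions of the second kind belonging to the
  polynomials \<open>P\<close> and \<open>P'\<close>. The limit constants of the functions of the second kind are kept
  independent of those of the polynomials so that the notion is stable under \<open>x \<mapsto> q x\<close>.\<close>

definition fundamental ::
  "nat \<Rightarrow> (complex \<Rightarrow> complex) \<Rightarrow> complex poly \<Rightarrow> complex poly \<Rightarrow> complex poly \<Rightarrow> complex poly \<Rightarrow>
   complex \<Rightarrow> complex \<Rightarrow> complex \<Rightarrow> bool"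
where
  "fundamental n \<phi> P P' R R' \<gamma> \<kappa> \<kappa>' \<longleftrightarrow>
     ((\<lambda>x. poly P x / x ^ n) \<longlongrightarrow> \<gamma>) at_infinity \<and>
     ((\<lambda>x. poly P' x / x ^ n) \<longlongrightarrow> 0) at_infinity \<and>
     ((\<lambda>x. x ^ Suc n * (poly P x * \<phi> x - poly R x)) \<longlongrightarrow> \<kappa>) at_infinity \<and>
     ((\<lambda>x. x ^ n * (poly P' x * \<phi> x - poly R' x)) \<longlongrightarrow> \<kappa>') at_infinity"

lemma eventually_nonzero_at_infinity: "eventually (\<lambda>x::complex. x \<noteq> 0) at_infinity"
  by (rule eventually_at_infinityI[of 1]) auto

text \<open>With \<open>Q = P \<phi> - R\<close> and \<open>Q' = P' \<phi> - R'\<close> the terms in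
  \<open>\<phi>\<close> cancel, so the left side equals \<open>P Q' - P' Q\<close>. It is thus a
  polynomial with a finite limit at infinity, hence constant.\<close>

lemma fundamental_casoratian:
  assumes "fundamental n \<phi> P P' R R' \<gamma> \<kappa> \<kappa>'"
  shows "poly P' x * poly R x - poly P x * poly R' x = \<gamma> * \<kappa>'"
proof -
  let ?Q = "\<lambda>x. poly P x * \<phi> x - poly R x" and ?Q' = "\<lambda>x. poly P' x * \<phi> x - poly R' x"
  have "((\<lambda>x. (poly P x / x ^ n) * (x ^ n * ?Q' x) -
      (poly P' x / x ^ n) * (x ^ Suc n * ?Q x) * (1 / x ^ 1)) \<longlongrightarrow> \<gamma> * \<kappa>' - 0 * \<kappa> * 0) at_infinity"
    using assms unfolding fundamental_def
    by (intro tendsto_diff tendsto_mult inverse_power_tendsto_0) auto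
  moreover have "eventually (\<lambda>x. (poly P x / x ^ n) * (x ^ n * ?Q' x) -
      (poly P' x / x ^ n) * (x ^ Suc n * ?Q x) * (1 / x ^ 1) = poly (P' * R - P * R') x / x ^ 0) at_infinity"
    using eventually_nonzero_at_infinity by eventually_elim (simp add: field_simps)
  ultimately have "((\<lambda>x. poly (P' * R - P * R') x / x ^ 0) \<longlongrightarrow> \<gamma> * \<kappa>' - 0 * \<kappa> * 0) at_infinity"
    by (rule Lim_transform_eventually)
  from poly_limit_imp_degree[OF this] have "degree (P' * R - P * R') = 0"
    "coeff (P' * R - P * R') 0 = \<gamma> * \<kappa>'" by simp_all
  then have "P' * R - P * R' = [:\<gamma> * \<kappa>':]"
    by (metis coeff_pCons_0 degree_eq_zeroE)
  then have "poly (P' * R - P * R') x = \<gamma> * \<kappa>'" by simp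
  then show ?thesis by simp
qed

text \<open>Makes the system at \<open>q * x\<close> available as the second system of a transfer
  matrix.\<close>

lemma fundamental_dilate:
  assumes "fundamental n \<phi> P P' R R' \<gamma> \<kappa> \<kappa>'" "q \<noteq> 0"
  shows "fundamental n (\<lambda>x. \<phi> (q * x)) (P \<circ>\<^sub>p [:0, q:]) (P' \<circ>\<^sub>p [:0, q:])
    (R \<circ>\<^sub>p [:0, q:]) (R' \<circ>\<^sub>p [:0, q:]) (q ^ n * \<gamma>) (\<kappa> / q ^ Suc n) (\<kappa>' / q ^ n)"
proof -
  have dil: "filterlim (\<lambda>x. q * x) at_infinity at_infinity"
    using assms(2) by (intro tendsto_mult_filterlim_at_infinity[of _ q] filterlim_ident) auto
  note lim = assms(1)[unfolded fundamental_def]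
  have l: "((\<lambda>x. c * h (q * x)) \<longlongrightarrow> c * l) at_infinity" if "(h \<longlongrightarrow> l) at_infinity"
    for h :: "complex \<Rightarrow> complex" and c l
    using filterlim_compose[OF that dil] by (rule tendsto_mult_left)
  have eqs: "poly P (q * x) / x ^ n = q ^ n * (poly P (q * x) / (q * x) ^ n)"
    "poly P' (q * x) / x ^ n = q ^ n * (poly P' (q * x) / (q * x) ^ n)"
    "x ^ n * z = (1 / q ^ n) * ((q * x) ^ n * z)"
    "x ^ Suc n * z = (1 / q ^ Suc n) * ((q * x) ^ Suc n * z)" for x z
    using assms(2) by (simp_all add: power_mult_distrib)
  have pc: "poly (r \<circ>\<^sub>p [:0, q:]) x = poly r (q * x)" for r x
    by (simp add: poly_pcompose mult.commute)
  show ?thesis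
    unfolding fundamental_def pc
  proof (intro conjI)
    show "((\<lambda>x. poly P (q * x) / x ^ n) \<longlongrightarrow> q ^ n * \<gamma>) at_infinity"
      unfolding eqs(1) using lim by (intro l[of "\<lambda>x. poly P x / x ^ n"]) auto
    show "((\<lambda>x. poly P' (q * x) / x ^ n) \<longlongrightarrow> 0) at_infinity"
      unfolding eqs(2) using lim l[of "\<lambda>x. poly P' x / x ^ n" 0 "q ^ n"] by simp
    show "((\<lambda>x. x ^ Suc n * (poly P (q * x) * \<phi> (q * x) - poly R (q * x))) \<longlongrightarrow> \<kappa> / q ^ Suc n) at_infinity"
      using l[of "\<lambda>x. x ^ Suc n * (poly P x * \<phi> x - poly R x)" \<kappa> "1 / q ^ Suc n"] lim
      unfolding eqs(4)[symmetric] by simp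
    show "((\<lambda>x. x ^ n * (poly P' (q * x) * \<phi> (q * x) - poly R' (q * x))) \<longlongrightarrow> \<kappa>' / q ^ n) at_infinity"
      using l[of "\<lambda>x. x ^ n * (poly P' x * \<phi> x - poly R' x)" \<kappa>' "1 / q ^ n"] lim
      unfolding eqs(3)[symmetric] by simp
  qed
qed

text \<open>Multiplying the row \<open>(X, X \<psi> - V)\<close> by \<open>diag(ep, em)\<close> and eliminating \<open>\<psi>\<close> by means of
  \<open>em \<psi> = ep \<phi> + C\<close> turns every relation between the rows into relations between the
  polynomials \<open>ep X\<close>, \<open>em V - C X\<close> and the polynomials of the first system.\<close>

lemma transfer_matrix:
  assumes f1: "fundamental n \<phi> P P' R R' \<gamma> \<kappa> \<kappa>'"
    and f2: "fundamental n \<psi> X X' V V' \<gamma>2 \<kappa>2 \<kappa>2'"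
    and nz: "\<gamma> \<noteq> 0" "\<kappa>' \<noteq> 0"
    and rel: "eventually (\<lambda>x. poly em x * \<psi> x = poly ep x * \<phi> x + poly C x) at_infinity"
    and lim: "((\<lambda>x. poly ep x / x ^ Suc d) \<longlongrightarrow> \<epsilon>p) at_infinity"
      "((\<lambda>x. poly em x / x ^ Suc d) \<longlongrightarrow> \<epsilon>m) at_infinity"
  obtains M11 M12 M21 M22 where
    "\<And>x. poly ep x * poly X x = poly M11 x * poly P x + poly M12 x * poly P' x"
    "\<And>x. poly em x * poly V x - poly C x * poly X x = poly M11 x * poly R x + poly M12 x * poly R' x"
    "\<And>x. poly ep x * poly X' x = poly M21 x * poly P x + poly M22 x * poly P' x"
    "\<And>x. poly em x * poly V' x - poly C x * poly X' x = poly M21 x * poly R x + poly M22 x * poly R' x"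
    "degree M11 \<le> Suc d" "coeff M11 (Suc d) = \<epsilon>p * \<gamma>2 / \<gamma>"
    "degree M12 \<le> d" "coeff M12 d = (\<epsilon>m * \<kappa>2 * \<gamma> - \<epsilon>p * \<gamma>2 * \<kappa>) / (\<gamma> * \<kappa>')"
    "degree M22 \<le> Suc d" "coeff M22 (Suc d) = \<epsilon>m * \<kappa>2' / \<kappa>'"
proof -
  define \<delta> where "\<delta> = \<gamma> * \<kappa>'"
  have \<delta>: "\<delta> \<noteq> 0" and cas: "\<And>x. poly P' x * poly R x - poly P x * poly R' x = \<delta>"
    using nz fundamental_casoratian[OF f1] by (auto simp: \<delta>_def)
  \<comment> \<open>Cramer's rule: \<open>M Z S P' R'\<close> and \<open>- M Z S P R\<close> are the
    coefficients of the row \<open>(ep Z, em S - C Z)\<close> in terms of \<open>(P, R)\<close> and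
    \<open>(P', R')\<close>. The determinant is constant, so they are polynomials.\<close>
  define M where "M Z S Z1 S1 = smult (1 / \<delta>) (- ep * Z * S1 + (em * S - C * Z) * Z1)" for Z S Z1 S1
  have M: "poly (M Z S Z1 S1) x = (- poly ep x * poly Z x * poly S1 x +
      (poly em x * poly S x - poly C x * poly Z x) * poly Z1 x) / \<delta>" for Z S Z1 S1 x
    unfolding M_def by simp
  have rows: "poly ep x * poly Z x = poly (M Z S P' R') x * poly P x + poly (- M Z S P R) x * poly P' x"
    "poly em x * poly S x - poly C x * poly Z x = poly (M Z S P' R') x * poly R x + poly (- M Z S P R) x * poly R' x"
    for Z S x
  proof -
    have "\<delta> * (poly ep x * poly Z x) = \<delta> * (poly (M Z S P' R') x * poly P x + poly (- M Z S P R) x * poly P' x)"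
      unfolding M poly_minus using \<delta> by (simp add: field_simps) (simp add: cas[of x, symmetric] algebra_simps)
    then show "poly ep x * poly Z x = poly (M Z S P' R') x * poly P x + poly (- M Z S P R) x * poly P' x"
      using \<delta> by simp
    have "\<delta> * (poly em x * poly S x - poly C x * poly Z x) = \<delta> * (poly (M Z S P' R') x * poly R x + poly (- M Z S P R) x * poly R' x)"
      unfolding M poly_minus using \<delta> by (simp add: field_simps) (simp add: cas[of x, symmetric] algebra_simps)
    then show "poly em x * poly S x - poly C x * poly Z x = poly (M Z S P' R') x * poly R x + poly (- M Z S P R) x * poly R' x"
      using \<delta> by simp
  qed
  \<comment> \<open>The same cofactors in terms of functions of the second kind, whose decay is
    known; \<open>rel\<close> makes the contributions of \<open>\<phi>\<close> and
    \<open>\<psi>\<close> cancel against \<open>C\<close>.\<close>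
  have Mq: "eventually (\<lambda>x. poly (M Z S Z1 S1) x = (poly ep x * poly Z x * (poly Z1 x * \<phi> x - poly S1 x) -
      poly em x * (poly Z x * \<psi> x - poly S x) * poly Z1 x) / \<delta>) at_infinity" for Z S Z1 S1
    using rel
  proof eventually_elim
    case (elim x)
    have "poly ep x * poly Z x * (poly Z1 x * \<phi> x - poly S1 x) - poly em x * (poly Z x * \<psi> x - poly S x) * poly Z1 x
      = poly Z x * poly Z1 x * (poly ep x * \<phi> x - poly em x * \<psi> x) - poly ep x * poly Z x * poly S1 x
        + poly em x * poly S x * poly Z1 x"
      by (simp add: algebra_simps)
    also have "poly ep x * \<phi> x - poly em x * \<psi> x = - poly C x" by (simp add: elim)
    finally show ?case unfolding M by (simp add: algebra_simps)
  qed
  let ?Q = "\<lambda>x. poly P x * \<phi> x - poly R x" and ?Q' = "\<lambda>x. poly P' x * \<phi> x - poly R' x"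
  let ?S = "\<lambda>x. poly X x * \<psi> x - poly V x" and ?S' = "\<lambda>x. poly X' x * \<psi> x - poly V' x"
  note lims = f1[unfolded fundamental_def] f2[unfolded fundamental_def] lim
  have inv: "((\<lambda>x::complex. 1 / x ^ 1) \<longlongrightarrow> 0) at_infinity" by (rule inverse_power_tendsto_0) simp
  \<comment> \<open>Each entry is a combination of factors with known limits; an extra
    \<open>1 / x ^ 1\<close> marks the subdominant term. In \<open>M12\<close> both terms have the
    same order, whence the difference in its leading coefficient.\<close>
  have "((\<lambda>x. ((poly ep x / x ^ Suc d) * (poly X x / x ^ n) * (x ^ n * ?Q' x) -
      (poly em x / x ^ Suc d) * (x ^ Suc n * ?S x) * (poly P' x / x ^ n) * (1 / x ^ 1)) / \<delta>)
      \<longlongrightarrow> (\<epsilon>p * \<gamma>2 * \<kappa>' - \<epsilon>m * \<kappa>2 * 0 * 0) / \<delta>) at_infinity"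
    using lims inv \<delta> by (intro tendsto_divide tendsto_diff tendsto_mult tendsto_const) auto
  moreover have "eventually (\<lambda>x. ((poly ep x / x ^ Suc d) * (poly X x / x ^ n) * (x ^ n * ?Q' x) -
      (poly em x / x ^ Suc d) * (x ^ Suc n * ?S x) * (poly P' x / x ^ n) * (1 / x ^ 1)) / \<delta> =
      poly (M X V P' R') x / x ^ Suc d) at_infinity"
    using eventually_nonzero_at_infinity Mq[of X V P' R'] by eventually_elim (simp add: divide_simps)
  ultimately have l11: "((\<lambda>x. poly (M X V P' R') x / x ^ Suc d) \<longlongrightarrow> (\<epsilon>p * \<gamma>2 * \<kappa>' - \<epsilon>m * \<kappa>2 * 0 * 0) / \<delta>) at_infinity"
    by (rule Lim_transform_eventually)
  have "((\<lambda>x. - ((poly ep x / x ^ Suc d) * (poly X x / x ^ n) * (x ^ Suc n * ?Q x) -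
      (poly em x / x ^ Suc d) * (x ^ Suc n * ?S x) * (poly P x / x ^ n)) / \<delta>)
      \<longlongrightarrow> - (\<epsilon>p * \<gamma>2 * \<kappa> - \<epsilon>m * \<kappa>2 * \<gamma>) / \<delta>) at_infinity"
    using lims inv \<delta> by (intro tendsto_divide tendsto_diff tendsto_mult tendsto_const tendsto_minus) auto
  moreover have "eventually (\<lambda>x. - ((poly ep x / x ^ Suc d) * (poly X x / x ^ n) * (x ^ Suc n * ?Q x) -
      (poly em x / x ^ Suc d) * (x ^ Suc n * ?S x) * (poly P x / x ^ n)) / \<delta> =
      poly (- M X V P R) x / x ^ d) at_infinity"
    using eventually_nonzero_at_infinity Mq[of X V P R] by eventually_elim (simp add: divide_simps)
  ultimately have l12: "((\<lambda>x. poly (- M X V P R) x / x ^ d) \<longlongrightarrow> - (\<epsilon>p * \<gamma>2 * \<kappa> - \<epsilon>m * \<kappa>2 * \<gamma>) / \<delta>) at_infinity"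
    by (rule Lim_transform_eventually)
  have "((\<lambda>x. - ((poly ep x / x ^ Suc d) * (poly X' x / x ^ n) * (x ^ Suc n * ?Q x) * (1 / x ^ 1) -
      (poly em x / x ^ Suc d) * (x ^ n * ?S' x) * (poly P x / x ^ n)) / \<delta>)
      \<longlongrightarrow> - (\<epsilon>p * 0 * \<kappa> * 0 - \<epsilon>m * \<kappa>2' * \<gamma>) / \<delta>) at_infinity"
    using lims inv \<delta> by (intro tendsto_divide tendsto_diff tendsto_mult tendsto_const tendsto_minus) auto
  moreover have "eventually (\<lambda>x. - ((poly ep x / x ^ Suc d) * (poly X' x / x ^ n) * (x ^ Suc n * ?Q x) * (1 / x ^ 1) -
      (poly em x / x ^ Suc d) * (x ^ n * ?S' x) * (poly P x / x ^ n)) / \<delta> =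
      poly (- M X' V' P R) x / x ^ Suc d) at_infinity"
    using eventually_nonzero_at_infinity Mq[of X' V' P R] by eventually_elim (simp add: divide_simps)
  ultimately have l22: "((\<lambda>x. poly (- M X' V' P R) x / x ^ Suc d) \<longlongrightarrow> - (\<epsilon>p * 0 * \<kappa> * 0 - \<epsilon>m * \<kappa>2' * \<gamma>) / \<delta>) at_infinity"
    by (rule Lim_transform_eventually)
  show ?thesis
  proof (rule that[of "M X V P' R'" "- M X V P R" "M X' V' P' R'" "- M X' V' P R"])
    show "coeff (M X V P' R') (Suc d) = \<epsilon>p * \<gamma>2 / \<gamma>"
      "coeff (- M X V P R) d = (\<epsilon>m * \<kappa>2 * \<gamma> - \<epsilon>p * \<gamma>2 * \<kappa>) / (\<gamma> * \<kappa>')"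
      "coeff (- M X' V' P R) (Suc d) = \<epsilon>m * \<kappa>2' / \<kappa>'"
      unfolding poly_limit_imp_degree(2)[OF l11] poly_limit_imp_degree(2)[OF l12]
        poly_limit_imp_degree(2)[OF l22]
      using nz by (simp_all add: \<delta>_def field_simps)
  qed (use rows poly_limit_imp_degree(1)[OF l11] poly_limit_imp_degree(1)[OF l12]
        poly_limit_imp_degree(1)[OF l22] in simp_all)
qed

context jackson_weight
begin

section \<open>Fundamental systems of orthonormal polynomials\<close>

lemma orthonormal_moment:
  assumes "orthonormal_polys q \<alpha> \<beta> w p"
  shows "degree (p k) = k" "moment (p n * p m) = (if n = m then 1 else 0)" "lead_coeff (p k) \<noteq> 0"
proof -
  show deg: "degree (p k) = k" for k using assms by (simp add: orthonormal_polys_def)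
  show mom: "moment (p n * p m) = (if n = m then 1 else 0)" for n m
    using assms by (simp add: orthonormal_polys_def moment_def mult.assoc)
  have "p k \<noteq> 0"
    using mom[of k k] by (auto simp: moment_def jackson_def jackson0_def)
  then show "lead_coeff (p k) \<noteq> 0" by simp
qed

text \<open>Subtracting multiples of \<open>p m\<close> removes the coefficients of \<open>r\<close>
  from the top down. The \<open>p m\<close> with \<open>m < n\<close> are orthogonal to
  \<open>p n\<close>, so only the coefficient of index \<open>n\<close> survives.\<close>

lemma orthonormal_moment_mult:
  assumes orth: "orthonormal_polys q \<alpha> \<beta> w p" and "degree r \<le> n"
  shows "moment (p n * r) = coeff r n / lead_coeff (p n)"
proof -
  note orth = orthonormal_moment[OF orth]
  have reduce: "coeff (r - smult (coeff r m / lead_coeff (p m)) (p m)) i = 0"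
    if "\<And>i. i > m \<Longrightarrow> coeff r i = 0" "i \<ge> m" for r m i
    using that orth(1)[of m] orth(3)[of m] by (cases "i = m") (auto simp: coeff_eq_0)
  have split: "moment (p n * r) = moment (p n * (r - smult c (p m))) + c * moment (p n * p m)" for r c m
    by (simp add: right_diff_distrib moment_diff moment_smult)
  have low: "moment (p n * r) = 0" if "\<And>i. i \<ge> m \<Longrightarrow> coeff r i = 0" "m \<le> n" for r m
    using that
  proof (induction m arbitrary: r)
    case 0
    then have "r = 0" by (simp add: poly_eq_iff)
    then show ?case by (simp add: moment_def jackson_def jackson0_def)
  next
    case (Suc m)
    have "moment (p n * (r - smult (coeff r m / lead_coeff (p m)) (p m))) = 0"
      using Suc.prems by (intro Suc.IH reduce) auto
    then show ?case
      using split[of r "coeff r m / lead_coeff (p m)" m] Suc.prems(2) orth(2)[of n m] by simp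
  qed
  have "moment (p n * (r - smult (coeff r n / lead_coeff (p n)) (p n))) = 0"
    using assms(2) by (intro low[of n] reduce) (auto simp: coeff_eq_0)
  then show ?thesis
    using split[of r "coeff r n / lead_coeff (p n)" n] orth(2)[of n n] by simp
qed

text \<open>The moments of \<open>x ^ k\<close> times \<open>p n\<close> vanish for
  \<open>k < n\<close>, so up to exponent \<open>n\<close> the powers of \<open>x\<close> move
  freely under the integral. The next multiplication by \<open>x\<close> meets the first nonzero
  moment, which is the limit.\<close>

lemma second_kind_asymptotics:
  assumes orth: "orthonormal_polys q \<alpha> \<beta> w p"
  shows "((\<lambda>x. x ^ Suc n * skind (p n) x) \<longlongrightarrow> 1 / lead_coeff (p n)) at_infinity"
proof -
  have step: "x * skind r x = skind (pCons 0 r) x + moment r" if "off x" for x r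
    using skind_pCons[OF that, of 0 r] by simp
  have mom: "moment (monom 1 k * p n) = (if k = n then 1 / lead_coeff (p n) else 0)" if "k \<le> n" for k
    using orthonormal_moment_mult[OF orth, of "monom 1 k" n] that
    by (simp add: degree_monom_eq mult.commute)
  have pow: "x ^ k * skind (p n) x = skind (monom 1 k * p n) x" if "k \<le> n" "off x" for k x
    using that(1)
  proof (induction k)
    case (Suc k)
    then have "x ^ Suc k * skind (p n) x = x * skind (monom 1 k * p n) x" by simp
    then show ?case using step[OF that(2)] mom[of k] Suc.prems by (simp add: monom_Suc)
  qed simp
  have eq: "skind (monom 1 (Suc n) * p n) x + 1 / lead_coeff (p n) = x ^ Suc n * skind (p n) x"
    if "off x" for x
    using step[OF that, of "monom 1 n * p n"] mom[of n]
    by (simp add: monom_Suc pow[of n, OF _ that, symmetric] mult.assoc)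
  have "((\<lambda>x. skind (monom 1 (Suc n) * p n) x + 1 / lead_coeff (p n)) \<longlongrightarrow> 0 + 1 / lead_coeff (p n)) at_infinity"
    by (intro tendsto_add skind_tendsto_0 tendsto_const)
  from Lim_transform_eventually[OF this eventually_mono[OF eventually_off_at_infinity eq]]
  show ?thesis by simp
qed

text \<open>In terms of recurrence data \<open>\<gamma>'\<close> is the leading coefficient times
  the recurrence coefficient of index \<open>n\<close>: this is the previous leading coefficient for
  \<open>n > 0\<close> and \<open>a0 * \<gamma>\<close> for \<open>n = 0\<close>.\<close>

lemma orthonormal_fundamental:
  assumes orth: "orthonormal_polys q \<alpha> \<beta> w p" and a0: "a0 \<noteq> 0"
  obtains P' R R' \<gamma> \<gamma>' where "\<gamma> \<noteq> 0" "\<gamma>' \<noteq> 0"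
    "fundamental n stj (p n) P' R R' \<gamma> (1 / \<gamma>) (1 / \<gamma>')"
    "\<And>x. off x \<Longrightarrow> Y_matrix q \<alpha> \<beta> w a0 p n x =
      vector [vector [poly (p n) x, (poly (p n) x * stj x - poly R x) / w x],
              vector [poly P' x, (poly P' x * stj x - poly R' x) / w x]]"
proof -
  note deg = orthonormal_moment(1)[OF orth] and lc = orthonormal_moment(3)[OF orth]
  define \<gamma> where "\<gamma> = lead_coeff (p n)"
  obtain R where R: "\<And>x. off x \<Longrightarrow> skind (p n) x = poly (p n) x * stj x - poly R x"
    using skind_numerator by blast
  have transform: "(g \<longlongrightarrow> l) at_infinity"
    if "(f \<longlongrightarrow> l) at_infinity" "\<And>x. off x \<Longrightarrow> f x = g x" for f g :: "complex \<Rightarrow> complex" and l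
    using that(1) eventually_mono[OF eventually_off_at_infinity that(2)]
    by (rule Lim_transform_eventually)
  have P: "((\<lambda>x. poly (p n) x / x ^ n) \<longlongrightarrow> \<gamma>) at_infinity"
    using poly_over_power_tendsto[of "p n" n] deg[of n] by (simp add: \<gamma>_def)
  have Q: "((\<lambda>x. x ^ Suc n * (poly (p n) x * stj x - poly R x)) \<longlongrightarrow> 1 / \<gamma>) at_infinity"
    unfolding \<gamma>_def by (rule transform[OF second_kind_asymptotics[OF orth]]) (simp add: R)
  show ?thesis
  proof (cases n)
    case 0
    show ?thesis
    \<comment> \<open>The convention for index -1: polynomial 0 and second-kind function
      \<open>1 / (a0 * \<gamma>)\<close>, encoded by a constant numerator of opposite sign.\<close>
    proof (rule that[of \<gamma> "a0 * \<gamma>" 0 R "[:- 1 / (a0 * \<gamma>):]"])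
      show "fundamental n stj (p n) 0 R [:- 1 / (a0 * \<gamma>):] \<gamma> (1 / \<gamma>) (1 / (a0 * \<gamma>))"
        unfolding fundamental_def using P Q 0 by simp
    qed (use lc[of n] a0 R 0 in \<open>auto simp: \<gamma>_def Y_matrix_def\<close>)
  next
    case (Suc m)
    obtain R' where R': "\<And>x. off x \<Longrightarrow> skind (p m) x = poly (p m) x * stj x - poly R' x"
      using skind_numerator by blast
    show ?thesis
    proof (rule that[of \<gamma> "lead_coeff (p m)" "p m" R R'])
      have "((\<lambda>x. poly (p m) x / x ^ n) \<longlongrightarrow> 0) at_infinity"
        using poly_over_power_tendsto[of "p m" n] deg[of m] Suc by (simp add: coeff_eq_0)
      moreover have "((\<lambda>x. x ^ n * (poly (p m) x * stj x - poly R' x)) \<longlongrightarrow> 1 / lead_coeff (p m)) at_infinity"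
        unfolding Suc by (rule transform[OF second_kind_asymptotics[OF orth]]) (simp add: R')
      ultimately show "fundamental n stj (p n) (p m) R R' \<gamma> (1 / \<gamma>) (1 / lead_coeff (p m))"
        unfolding fundamental_def using P Q by simp
    qed (use lc[of n] lc[of m] R R' Suc in \<open>auto simp: \<gamma>_def Y_matrix_def\<close>)
  qed
qed

end

lemma countable_dilated:
  fixes q :: complex
  assumes "countable {x. \<not> A x}" "q \<noteq> 0"
  shows "countable {x. \<not> A (q * x)}"
proof -
  have "{x. \<not> A (q * x)} \<subseteq> (\<lambda>y. y / q) ` {x. \<not> A x}"
    using assms(2) by (auto simp: image_iff intro!: exI[of _ "q * _"])
  then show ?thesis using assms(1) by (meson countable_image countable_subset)
qed

text \<open>Brings the spectral matrix into the form produced by \<open>transfer_matrix\<close>. The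
  weight is cleared first, then the Stieltjes function; the resulting identities hold outside a
  countable set and hence everywhere.\<close>

lemma (in jackson_weight) spectral_matrix_rows:
  assumes Y: "\<And>x. off x \<Longrightarrow> Y_matrix q \<alpha> \<beta> w a0 p n x =
      vector [vector [poly P x, (poly P x * stj x - poly R x) / w x],
              vector [poly P' x, (poly P' x * stj x - poly R' x) / w x]]"
    and A: "spectral_matrix q \<alpha> \<beta> w (poly ep) a0 p n Wp Tp Tm Wm"
    and rel: "\<And>x. off x \<Longrightarrow> off (q * x) \<Longrightarrow> poly em x * stj (q * x) = poly ep x * stj x + poly C x"
    and w: "\<And>x. w x \<noteq> 0 \<Longrightarrow> poly em x * w (q * x) = poly ep x * w x"
    and w_zeros: "countable {x. w x = 0}" and q: "q \<noteq> 0"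
  shows "poly ep x * poly P (q * x) = poly Wp x * poly P x - poly Tp x * poly P' x"
    "poly em x * poly R (q * x) - poly C x * poly P (q * x) = poly Wp x * poly R x - poly Tp x * poly R' x"
    "poly ep x * poly P' (q * x) = poly Tm x * poly P x + poly Wm x * poly P' x"
    "poly em x * poly R' (q * x) - poly C x * poly P' (q * x) = poly Tm x * poly R x + poly Wm x * poly R' x"
proof -
  define B where "B = {x. \<not> off x} \<union> {x. \<not> off (q * x)} \<union> {x. w x = 0} \<union> {x. w (q * x) = 0}"
  have B: "countable B"
    unfolding B_def
    using countable_not_off w_zeros countable_dilated[OF _ q, of off] countable_dilated[OF _ q, of "\<lambda>x. w x \<noteq> 0"]
    by simp
  have rows: "poly ep x * poly P (q * x) = poly Wp x * poly P x - poly Tp x * poly P' x \<and>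
    poly em x * poly R (q * x) - poly C x * poly P (q * x) = poly Wp x * poly R x - poly Tp x * poly R' x \<and>
    poly ep x * poly P' (q * x) = poly Tm x * poly P x + poly Wm x * poly P' x \<and>
    poly em x * poly R' (q * x) - poly C x * poly P' (q * x) = poly Tm x * poly R x + poly Wm x * poly R' x"
    if "x \<notin> B" for x
  proof -
    have x: "off x" "off (q * x)" "w x \<noteq> 0" "w (q * x) \<noteq> 0" using that by (auto simp: B_def)
    have "mat (poly ep x) ** Y_matrix q \<alpha> \<beta> w a0 p n (q * x) =
        vector [vector [poly Wp x, - poly Tp x], vector [poly Tm x, poly Wm x]] **
          Y_matrix q \<alpha> \<beta> w a0 p n x"
      using A x unfolding spectral_matrix_def by blast
    then have e: "poly ep x * poly P (q * x) = poly Wp x * poly P x - poly Tp x * poly P' x"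
      "poly ep x * ((poly P (q * x) * stj (q * x) - poly R (q * x)) / w (q * x)) =
        poly Wp x * ((poly P x * stj x - poly R x) / w x) - poly Tp x * ((poly P' x * stj x - poly R' x) / w x)"
      "poly ep x * poly P' (q * x) = poly Tm x * poly P x + poly Wm x * poly P' x"
      "poly ep x * ((poly P' (q * x) * stj (q * x) - poly R' (q * x)) / w (q * x)) =
        poly Tm x * ((poly P x * stj x - poly R x) / w x) + poly Wm x * ((poly P' x * stj x - poly R' x) / w x)"
      unfolding Y[OF x(1)] Y[OF x(2)]
      by (simp_all add: vec_eq_iff forall_2 matrix_matrix_mult_def sum_2 mat_def vector_2)
    \<comment> \<open>The weight quotient turns the factor \<open>ep\<close> of the second column
      into \<open>em\<close>.\<close>
    have second: "poly em x * (Z * stj (q * x) - S) = m1 * (poly P x * stj x - poly R x) + m2 * (poly P' x * stj x - poly R' x)"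
      if "poly ep x * ((Z * stj (q * x) - S) / w (q * x)) =
        m1 * ((poly P x * stj x - poly R x) / w x) + m2 * ((poly P' x * stj x - poly R' x) / w x)" for Z S m1 m2
    proof -
      have "poly em x = poly ep x * w x / w (q * x)"
        using w[OF x(3)] x(4) by (simp add: field_simps)
      then have "poly em x * (Z * stj (q * x) - S) = w x * (poly ep x * ((Z * stj (q * x) - S) / w (q * x)))"
        by simp
      also have "\<dots> = m1 * (poly P x * stj x - poly R x) + m2 * (poly P' x * stj x - poly R' x)"
        unfolding that using x(3) by (simp add: field_simps)
      finally show ?thesis .
    qed
    \<comment> \<open>Subtracting \<open>stj x\<close> times the first-column relation leaves an
      identity between numerators.\<close>
    have numer: "poly em x * S - poly C x * Z = m1 * poly R x + m2 * poly R' x"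
      if "poly em x * (Z * stj (q * x) - S) = m1 * (poly P x * stj x - poly R x) + m2 * (poly P' x * stj x - poly R' x)"
        "poly ep x * Z = m1 * poly P x + m2 * poly P' x" for Z S m1 m2
    proof -
      have "poly em x * S - poly C x * Z = Z * (poly em x * stj (q * x)) - poly C x * Z -
          poly em x * (Z * stj (q * x) - S)" by (simp add: algebra_simps)
      also have "\<dots> = (poly ep x * Z) * stj x - poly em x * (Z * stj (q * x) - S)"
        unfolding rel[OF x(1,2)] by (simp add: algebra_simps)
      also have "\<dots> = m1 * poly R x + m2 * poly R' x"
        unfolding that by (simp add: algebra_simps)
      finally show ?thesis .
    qed
    show ?thesis
      using e numer[OF second[of "poly P (q * x)" "poly R (q * x)" "poly Wp x" "- poly Tp x"]]
        numer[OF second[of "poly P' (q * x)" "poly R' (q * x)" "poly Tm x" "poly Wm x"]]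
      by simp
  qed
  have pc: "poly (r \<circ>\<^sub>p [:0, q:]) x = poly r (q * x)" for r x
    by (simp add: poly_pcompose mult.commute)
  have "ep * (P \<circ>\<^sub>p [:0, q:]) = Wp * P - Tp * P'"
    "em * (R \<circ>\<^sub>p [:0, q:]) - C * (P \<circ>\<^sub>p [:0, q:]) = Wp * R - Tp * R'"
    "ep * (P' \<circ>\<^sub>p [:0, q:]) = Tm * P + Wm * P'"
    "em * (R' \<circ>\<^sub>p [:0, q:]) - C * (P' \<circ>\<^sub>p [:0, q:]) = Tm * R + Wm * R'"
    by (rule poly_eq_of_countable[OF B], simp add: pc rows)+
  from this[THEN arg_cong[of _ _ "\<lambda>r. poly r x"]]
  show "poly ep x * poly P (q * x) = poly Wp x * poly P x - poly Tp x * poly P' x"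
    "poly em x * poly R (q * x) - poly C x * poly P (q * x) = poly Wp x * poly R x - poly Tp x * poly R' x"
    "poly ep x * poly P' (q * x) = poly Tm x * poly P x + poly Wm x * poly P' x"
    "poly em x * poly R' (q * x) - poly C x * poly P' (q * x) = poly Tm x * poly R x + poly Wm x * poly R' x"
    by (simp_all add: pc)
qed

text \<open>Letting \<open>x\<close> tend to a root shows that \<open>S\<close> vanishes there. The
  roots are split off one after the other, so that a double root \<open>r1 = r2\<close> is covered;
  it occurs when \<open>b6\<close> is 1 or -1.\<close>

lemma poly_divisible_of_no_poles:
  fixes S :: "complex poly" and h :: "complex \<Rightarrow> complex"
  assumes "c \<noteq> 0"
    and eq: "\<And>r. r \<in> {r1, r2} \<Longrightarrow> eventually (\<lambda>x. poly S x = c * (x - r1) * (x - r2) * h x) (at r)"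
    and lim: "\<And>r. r \<in> {r1, r2} \<Longrightarrow> ((\<lambda>x. (x - r) * h x) \<longlongrightarrow> 0) (at r)"
  obtains G where "\<And>x. poly S x = c * (x - r1) * (x - r2) * poly G x"
proof -
  have root: "poly Z r = 0"
    if "r \<in> {r1, r2}" "eventually (\<lambda>x. poly Z x = k x * ((x - r) * h x)) (at r)" "(k \<longlongrightarrow> l) (at r)"
    for Z r k l
  proof -
    have "((\<lambda>x. k x * ((x - r) * h x)) \<longlongrightarrow> l * 0) (at r)"
      using that(1,3) by (intro tendsto_mult lim)
    then have "(poly Z \<longlongrightarrow> l * 0) (at r)"
      using that(2) by (simp add: tendsto_cong)
    moreover have "(poly Z \<longlongrightarrow> poly Z r) (at r)"
      using poly_isCont isCont_def by blast
    ultimately show ?thesis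
      using tendsto_unique[OF trivial_limit_at] by fastforce
  qed
  have "poly S r1 = 0"
    by (rule root[of _ _ "\<lambda>x. c * (x - r2)"])
      (auto intro!: tendsto_eq_intros eventually_mono[OF eq[of r1]])
  then obtain S1 where S1: "S = [:- r1, 1:] * S1"
    by (auto simp: poly_eq_0_iff_dvd)
  have ne: "eventually (\<lambda>x. x \<noteq> r1) (at r2)"
    by (rule eventually_neq_at_within)
  have "poly S1 r2 = 0"
  proof (rule root[of _ _ "\<lambda>x. c"])
    show "eventually (\<lambda>x. poly S1 x = c * ((x - r2) * h x)) (at r2)"
      using eq[of r2, OF insertI2[OF singletonI]] ne
    proof eventually_elim
      case (elim x)
      then have "(x - r1) * poly S1 x = (x - r1) * (c * ((x - r2) * h x))"
        by (simp add: S1 algebra_simps)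
      then show ?case using elim(2) by simp
    qed
  qed auto
  then obtain S2 where S2: "S1 = [:- r2, 1:] * S2"
    by (auto simp: poly_eq_0_iff_dvd)
  show ?thesis
    by (rule that[of "smult (1 / c) S2"]) (use assms(1) in \<open>simp add: S1 S2 algebra_simps\<close>)
qed

text \<open>The Casoratian is the determinant of the linear system for the coefficients; this allows
  two transfer matrices to be compared entrywise.\<close>

lemma transfer_unique:
  fixes P P' R R' :: complex
  assumes "P' * R - P * R' \<noteq> 0"
    and "a1 * P + a2 * P' = b1 * P + b2 * P'" "a1 * R + a2 * R' = b1 * R + b2 * R'"
  shows "a1 = b1" "a2 = b2"
proof -
  have z: "(a1 - b1) * P + (a2 - b2) * P' = 0" "(a1 - b1) * R + (a2 - b2) * R' = 0"
    using assms(2,3) by (simp_all add: algebra_simps)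
  have "(a1 - b1) * (P' * R - P * R') =
      P' * ((a1 - b1) * R + (a2 - b2) * R') - R' * ((a1 - b1) * P + (a2 - b2) * P')"
    "(a2 - b2) * (P' * R - P * R') =
      R * ((a1 - b1) * P + (a2 - b2) * P') - P * ((a1 - b1) * R + (a2 - b2) * R')"
    by (simp_all add: algebra_simps)
  \<comment> \<open>Both right-hand sides vanish by \<open>z\<close>.\<close>
  then show "a1 = b1" "a2 = b2" using assms(1) unfolding z by simp_all
qed

text \<open>Two successive steps equal \<open>k\<close> times a direct one. The last hypothesis
  matches the inhomogeneous terms: from \<open>e1m \<psi> = e1p \<phi> + c1\<close> and
  \<open>e2m \<chi> = e2p \<psi> + c2\<close> the composite relation has the term
  \<open>e1m * c2 + e2p * c1\<close>.\<close>

lemma transfer_compose: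
  fixes P P' R R' :: complex
  assumes "P' * R - P * R' \<noteq> 0"
    and "e1p * X = a1 * P + a2 * P'" "e1m * V - c1 * X = a1 * R + a2 * R'"
    and "e1p * X' = b1 * P + b2 * P'" "e1m * V' - c1 * X' = b1 * R + b2 * R'"
    and "e2p * Z = m1 * X + m2 * X'" "e2m * S - c2 * Z = m1 * V + m2 * V'"
    and "fp * Z = n1 * P + n2 * P'" "fm * S - g * Z = n1 * R + n2 * R'"
    and "e1p * e2p = k * fp" "e1m * e2m = k * fm" "e1m * c2 + e2p * c1 = k * g"
  shows "m1 * a1 + m2 * b1 = k * n1" "m1 * a2 + m2 * b2 = k * n2"
proof -
  have 1: "(m1 * a1 + m2 * b1) * P + (m1 * a2 + m2 * b2) * P' = (k * n1) * P + (k * n2) * P'"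
  proof -
    have "(m1 * a1 + m2 * b1) * P + (m1 * a2 + m2 * b2) * P' = m1 * (e1p * X) + m2 * (e1p * X')"
      unfolding assms(2,4) by (simp add: algebra_simps)
    also have "\<dots> = e1p * (e2p * Z)" unfolding assms(6) by (simp add: algebra_simps)
    also have "\<dots> = k * (fp * Z)" using assms(10) by (simp add: mult.assoc[symmetric])
    finally show ?thesis unfolding assms(8) by (simp add: algebra_simps)
  qed
  have 2: "(m1 * a1 + m2 * b1) * R + (m1 * a2 + m2 * b2) * R' = (k * n1) * R + (k * n2) * R'"
  proof -
    have "(m1 * a1 + m2 * b1) * R + (m1 * a2 + m2 * b2) * R' =
        m1 * (e1m * V - c1 * X) + m2 * (e1m * V' - c1 * X')"
      unfolding assms(3,5) by (simp add: algebra_simps)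
    also have "\<dots> = e1m * (m1 * V + m2 * V') - c1 * (m1 * X + m2 * X')" by (simp add: algebra_simps)
    also have "\<dots> = (e1m * e2m) * S - (e1m * c2 + e2p * c1) * Z"
      unfolding assms(6,7)[symmetric] by (simp add: algebra_simps)
    also have "\<dots> = k * (fm * S - g * Z)" unfolding assms(11,12) by (simp add: algebra_simps)
    finally show ?thesis unfolding assms(9) by (simp add: algebra_simps)
  qed
  show "m1 * a1 + m2 * b1 = k * n1" "m1 * a2 + m2 * b2 = k * n2"
    by (rule transfer_unique[OF assms(1) 1 2])+
qed

text \<open>Multiplicativity of determinants; the terms with \<open>c\<close> drop out because they
  add a multiple of one column to the other.\<close>

lemma transfer_det:
  fixes P P' R R' :: complex
  assumes "P' * R - P * R' \<noteq> 0"
    and "fp * X = a1 * P + a2 * P'" "fm * V - c * X = a1 * R + a2 * R'"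
    and "fp * X' = b1 * P + b2 * P'" "fm * V' - c * X' = b1 * R + b2 * R'"
  shows "(a1 * b2 - a2 * b1) * (P' * R - P * R') = fp * fm * (X' * V - X * V')"
proof -
  have "fp * fm * (X' * V - X * V') = (fp * X') * (fm * V - c * X) - (fp * X) * (fm * V' - c * X')"
    by (simp add: algebra_simps)
  also have "\<dots> = (a1 * b2 - a2 * b1) * (P' * R - P * R')"
    unfolding assms by (simp add: algebra_simps)
  finally show ?thesis by simp
qed

lemma poly_eq_sum_atMost:
  fixes p :: "complex poly"
  assumes "degree p \<le> d"
  shows "poly p x = (\<Sum>i\<le>d. coeff p i * x ^ i)"
  unfolding poly_altdef using assms by (intro sum.mono_neutral_left) (auto simp: coeff_eq_0)

text \<open>The conditions at \<open>gh\<close> and \<open>g\<close> determine the linear coefficients of the quadratic matrix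
  \<open>N\<close>; in particular the off-diagonal entry \<open>N12\<close> vanishes at \<open>1 / f\<close>, so the determinant
  factorizes there.\<close>

lemma q_painleve_algebra:
  fixes q t f g gh :: complex
  assumes nz: "q \<noteq> 0" "t \<noteq> 0" "f \<noteq> 0" "g \<noteq> 0" "gh \<noteq> 0" "b5 \<noteq> 0" "b6 \<noteq> 0" "u \<noteq> 0" "v \<noteq> 0" "\<beta> \<noteq> 0"
    and B11: "B11 = (\<lambda>x. c - u / b6 * x)" and B22: "B22 = (\<lambda>x. c' - b6 * v * x)"
    and N11: "N11 = (\<lambda>x. c / (q * t) + n1 * x + b5 / b6 * u * x\<^sup>2)"
    and N12: "N12 = (\<lambda>x. \<beta> / (q * t) + n2 * x)"
    and N22: "N22 = (\<lambda>x. c' / (q * t) + m * x + b6 / b5 * v * x\<^sup>2)"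
    and at_gh: "N11 gh = - (f * gh - 1) / (q * t) * B11 gh" "N12 gh = - (f * gh - 1) / (q * t) * \<beta>"
    and at_g: "B22 (q * g) * N12 g = \<beta> * N22 g"
    and det: "N11 (1 / f) * N22 (1 / f) - N12 (1 / f) * N21 = u * v * d"
  shows "(f * gh - 1) * (f * g - 1) * (f - b5 * q * t) * (f - t / b5) = q * t\<^sup>2 * f ^ 4 * d"
proof -
  have n2: "n2 = - \<beta> * f / (q * t)"
  proof -
    have "gh * n2 = gh * (- \<beta> * f / (q * t))"
      using at_gh(2) nz unfolding N12 by (simp add: field_simps add_eq_0_iff)
    then show ?thesis using nz(5) by (metis mult_left_cancel)
  qed
  have solve: "y * X = Y - A - Z" if "A + X * y + Z = Y" for A X y Y Z :: complex
    using that by (auto simp: algebra_simps)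
  have n1: "q * t * n1 = - (f * c + u / b6) + u / b6 * gh * (f - q * t * b5)"
  proof -
    have "q * t * N11 gh = - (f * gh - 1) * B11 gh"
      unfolding at_gh(1) using nz by simp
    moreover have "q * t * N11 gh = c + (q * t * n1) * gh + q * t * b5 * (u / b6) * gh\<^sup>2"
      unfolding N11 using nz by (simp add: algebra_simps)
    ultimately have "c + (q * t * n1) * gh + q * t * b5 * (u / b6) * gh\<^sup>2 =
        - (f * gh - 1) * (c - u / b6 * gh)" unfolding B11 by simp
    then have "gh * (q * t * n1) = - (f * gh - 1) * (c - u / b6 * gh) - c - q * t * b5 * (u / b6) * gh\<^sup>2"
      by (rule solve)
    also have "\<dots> = gh * (- (f * c + u / b6) + u / b6 * gh * (f - q * t * b5))"
      by (simp add: algebra_simps power2_eq_square add_divide_distrib diff_divide_distrib)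
    finally have "gh * (q * t * n1) = \<dots>" .
    then show ?thesis using nz by simp
  qed
  have m: "q * t * m = - (c' * f + b6 * q * v) + b6 * q * v * g * (f - t / b5)"
  proof -
    \<comment> \<open>By the value of \<open>n2\<close>, \<open>N12\<close> is its value at 0 times
      \<open>1 - f * x\<close>; hence \<open>\<beta>\<close> cancels from the condition at
      \<open>g\<close>.\<close>
    have "N12 g = \<beta> * ((1 - f * g) / (q * t))"
      unfolding N12 n2 using nz by (simp add: field_simps)
    then have "\<beta> * (B22 (q * g) * ((1 - f * g) / (q * t))) = \<beta> * N22 g"
      using at_g by (simp only: mult_ac)
    then have "B22 (q * g) * ((1 - f * g) / (q * t)) = N22 g"
      using nz(10) by (metis mult_left_cancel)
    then have "q * t * N22 g = B22 (q * g) * (1 - f * g)"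
      using nz by (simp add: field_simps)
    moreover have "q * t * N22 g = c' + (q * t * m) * g + q * v * b6 * (t / b5) * g\<^sup>2"
      unfolding N22 using nz by (simp add: algebra_simps)
    ultimately have "c' + (q * t * m) * g + q * v * b6 * (t / b5) * g\<^sup>2 =
        (c' - b6 * v * (q * g)) * (1 - f * g)" unfolding B22 by simp
    then have "g * (q * t * m) = (c' - b6 * v * (q * g)) * (1 - f * g) - c' - q * v * b6 * (t / b5) * g\<^sup>2"
      by (rule solve)
    also have "\<dots> = g * (- (c' * f + b6 * q * v) + b6 * q * v * g * (f - t / b5))"
      by (simp add: algebra_simps power2_eq_square add_divide_distrib diff_divide_distrib)
    finally have "g * (q * t * m) = \<dots>" .
    then show ?thesis using nz by simp
  qed
  have "N12 (1 / f) = 0" unfolding N12 n2 using nz by (simp add: field_simps)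
  then have det': "N11 (1 / f) * N22 (1 / f) = u * v * d" using det by simp
  \<comment> \<open>At \<open>1 / f\<close> the unknown constant \<open>c\<close> cancels and the
    remainder factorizes; the same happens to \<open>c'\<close> in the next step.\<close>
  have 1: "b6 * f\<^sup>2 * (q * t * N11 (1 / f)) = u * (f - b5 * q * t) * (f * gh - 1)"
  proof -
    have "f\<^sup>2 * (q * t * N11 (1 / f)) = c * f\<^sup>2 + (q * t * n1) * f + q * t * b5 / b6 * u"
      unfolding N11 using nz by (simp add: field_simps power2_eq_square)
    also have "\<dots> = c * f\<^sup>2 + (- (f * c + u / b6) + u / b6 * gh * (f - q * t * b5)) * f + q * t * b5 / b6 * u"
      unfolding n1 ..
    finally have e: "f\<^sup>2 * (q * t * N11 (1 / f)) = \<dots>" .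
    show ?thesis unfolding mult.assoc[of b6] e using nz by (simp add: field_simps power2_eq_square)
  qed
  have 2: "f\<^sup>2 * (q * t * N22 (1 / f)) = b6 * q * v * (f - t / b5) * (f * g - 1)"
  proof -
    have "f\<^sup>2 * (q * t * N22 (1 / f)) = c' * f\<^sup>2 + (q * t * m) * f + q * t * b6 / b5 * v"
      unfolding N22 using nz by (simp add: field_simps power2_eq_square)
    also have "\<dots> = c' * f\<^sup>2 + (- (c' * f + b6 * q * v) + b6 * q * v * g * (f - t / b5)) * f + q * t * b6 / b5 * v"
      unfolding m ..
    also have "\<dots> = b6 * q * v * (f - t / b5) * (f * g - 1)"
      using nz by (simp add: field_simps power2_eq_square)
    finally show ?thesis .
  qed
  have "(b6 * q * u * v) * ((f * gh - 1) * (f * g - 1) * (f - b5 * q * t) * (f - t / b5)) =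
      (u * (f - b5 * q * t) * (f * gh - 1)) * (b6 * q * v * (f - t / b5) * (f * g - 1))"
    by (simp add: mult_ac)
  also have "\<dots> = (b6 * f\<^sup>2 * (q * t * N11 (1 / f))) * (f\<^sup>2 * (q * t * N22 (1 / f)))"
    unfolding 1 2 ..
  also have "\<dots> = b6 * f\<^sup>2 * f\<^sup>2 * (q * t) * (q * t) * (N11 (1 / f) * N22 (1 / f))"
    by (simp only: mult_ac)
  also have "\<dots> = (b6 * q * u * v) * (q * t\<^sup>2 * f ^ 4 * d)"
    unfolding det' by (simp add: power2_eq_square power4_eq_xxxx mult_ac)
  finally show ?thesis using nz by simp
qed

subsection \<open>The q-difference equation\<close>

lemma filterlim_mult_at:
  fixes q r :: complex
  assumes "q \<noteq> 0"
  shows "filterlim (\<lambda>x. q * x) (at (q * r)) (at r)"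
  unfolding filterlim_at using assms
  by (auto intro!: tendsto_intros eventually_mono[OF eventually_neq_at_within[of r r]])

text \<open>Eliminating the Stieltjes function at \<open>(q * x, t)\<close> from the x-equation at
  \<open>x\<close> and the t-equation at \<open>q * x\<close> puts the common factor
  \<open>(b6 * t - x) * (t - b6 * x)\<close> on both remaining Stieltjes functions. They have no
  poles at its zeros, so the inhomogeneous term is divisible by it.\<close>

lemma stieltjes_diagonal_shift:
  assumes jw: "jackson_weight q \<alpha> \<beta> w" "jackson_weight q \<alpha>' \<beta>' w'"
    and nz: "q \<noteq> 0" "t \<noteq> 0" "b6 \<noteq> 0"
    and w0: "\<And>r. r \<in> {b6 * t, t / b6} \<Longrightarrow> w r = 0 \<and> w' (q * r) = 0"
    and x_rel: "\<And>x. off_nodes q \<alpha> \<beta> x \<Longrightarrow> off_nodes q \<alpha> \<beta> (q * x) \<Longrightarrow>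
      D_minus b2 b3 b6 t x * stieltjes q \<alpha> \<beta> w (q * x) =
      D_plus b1 b4 b6 t x * stieltjes q \<alpha> \<beta> w x + poly U x"
    and t_rel: "\<And>x. off_nodes q \<alpha> \<beta> x \<Longrightarrow> off_nodes q \<alpha>' \<beta>' x \<Longrightarrow>
      E_minus q b6 t x * stieltjes q \<alpha>' \<beta>' w' x = E_plus q b6 t x * stieltjes q \<alpha> \<beta> w x + poly T x"
  obtains G where
    "\<And>x. off_nodes q \<alpha> \<beta> x \<Longrightarrow> off_nodes q \<alpha> \<beta> (q * x) \<Longrightarrow> off_nodes q \<alpha>' \<beta>' (q * x) \<Longrightarrow>
      x \<noteq> b6 * t \<Longrightarrow> x \<noteq> t / b6 \<Longrightarrow>
      (1 - b2 * x) * (1 - b3 * x) * stieltjes q \<alpha>' \<beta>' w' (q * x) =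
      (1 - b1 * x) * (1 - b4 * x) * stieltjes q \<alpha> \<beta> w x + poly G x"
    "\<And>x. E_plus q b6 t (q * x) * poly U x + D_minus b2 b3 b6 t x * poly T (q * x) =
      q * (b6 * t - x) * (t - b6 * x) * poly G x"
proof -
  interpret J: jackson_weight q \<alpha> \<beta> w by fact
  interpret K: jackson_weight q \<alpha>' \<beta>' w' by fact
  \<comment> \<open>The inhomogeneous term of the elimination; \<open>h\<close> below is its
    quotient by the common factor wherever that factor is nonzero and the kernels are
    finite.\<close>
  define S where "S = [:q * t, - q / b6:] * U +
    [:1, - b2:] * [:1, - b3:] * [:b6 * t, - 1:] * (T \<circ>\<^sub>p [:0, q:])"
  have S: "poly S x = E_plus q b6 t (q * x) * poly U x + D_minus b2 b3 b6 t x * poly T (q * x)" for x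
    using nz by (simp add: S_def poly_pcompose E_plus_def D_minus_def field_simps)
  define h where "h x = (1 - b2 * x) * (1 - b3 * x) * K.stj (q * x) - (1 - b1 * x) * (1 - b4 * x) * J.stj x" for x
  have k: "q * b6 * (x - b6 * t) * (x - t / b6) = q * (b6 * t - x) * (t - b6 * x)" for x
    using nz by (simp add: field_simps)
  have Sh: "poly S x = q * b6 * (x - b6 * t) * (x - t / b6) * h x"
    if "J.off x" "J.off (q * x)" "K.off (q * x)" for x
  proof -
    have "E_minus q b6 t (q * x) * D_minus b2 b3 b6 t x * K.stj (q * x) =
        D_minus b2 b3 b6 t x * (E_plus q b6 t (q * x) * J.stj (q * x) + poly T (q * x))"
      using t_rel[OF that(2,3)] by (simp add: mult_ac)
    also have "\<dots> = E_plus q b6 t (q * x) * (D_minus b2 b3 b6 t x * J.stj (q * x)) + D_minus b2 b3 b6 t x * poly T (q * x)"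
      by (simp add: algebra_simps)
    also have "\<dots> = E_plus q b6 t (q * x) * D_plus b1 b4 b6 t x * J.stj x + poly S x"
      unfolding x_rel[OF that(1,2)] S by (simp add: algebra_simps)
    finally have "poly S x = E_minus q b6 t (q * x) * D_minus b2 b3 b6 t x * K.stj (q * x) -
        E_plus q b6 t (q * x) * D_plus b1 b4 b6 t x * J.stj x" by simp
    also have "E_minus q b6 t (q * x) * D_minus b2 b3 b6 t x =
        q * (b6 * t - x) * (t - b6 * x) * ((1 - b2 * x) * (1 - b3 * x))"
      by (simp add: E_minus_def D_minus_def algebra_simps)
    also have "E_plus q b6 t (q * x) * D_plus b1 b4 b6 t x =
        q * (b6 * t - x) * (t - b6 * x) * ((1 - b1 * x) * (1 - b4 * x))"
    proof -
      have "E_plus q b6 t (q * x) = q * (b6 * t - x) / b6"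
        by (simp add: E_plus_def algebra_simps)
      then show ?thesis using nz by (simp add: D_plus_def mult_ac)
    qed
    finally show ?thesis unfolding k h_def by (simp add: algebra_simps)
  qed
  have dil: "eventually (\<lambda>x. A (q * x)) (at r)" if "eventually A (at (q * r))" for A r
    using filterlim_mult_at[OF nz(1)] that unfolding filterlim_iff by blast
  obtain G where G: "\<And>x. poly S x = q * b6 * (x - b6 * t) * (x - t / b6) * poly G x"
  proof (rule poly_divisible_of_no_poles[of "q * b6" "b6 * t" "t / b6" S h])
    show "q * b6 \<noteq> 0" using nz by simp
    fix r assume r: "r \<in> {b6 * t, t / b6}"
    then have r0: "r \<noteq> 0" "q * r \<noteq> 0" using nz by auto
    show "eventually (\<lambda>x. poly S x = q * b6 * (x - b6 * t) * (x - t / b6) * h x) (at r)"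
      using J.eventually_off_at[OF r0(1)] dil[OF J.eventually_off_at[OF r0(2)]]
        dil[OF K.eventually_off_at[OF r0(2)]]
      by eventually_elim (rule Sh)
    have lim: "((\<lambda>x. (x - r) * J.stj x) \<longlongrightarrow> 0) (at r)"
      using J.stj_no_pole r0 w0[OF r] by simp
    have "((\<lambda>x. (q * x - q * r) * K.stj (q * x)) \<longlongrightarrow> 0) (at r)"
      using K.stj_no_pole[OF r0(2)] w0[OF r] filterlim_mult_at[OF nz(1)]
      by (auto intro: filterlim_compose[where g = "\<lambda>x. (x - q * r) * K.stj x"])
    from tendsto_mult_left[OF this, of "1 / q"]
    have "((\<lambda>x. (x - r) * K.stj (q * x)) \<longlongrightarrow> 0) (at r)"
      using nz by (simp add: right_diff_distrib[symmetric] mult.assoc)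
    then have "((\<lambda>x. (1 - b2 * x) * (1 - b3 * x) * ((x - r) * K.stj (q * x)) -
        (1 - b1 * x) * (1 - b4 * x) * ((x - r) * J.stj x)) \<longlongrightarrow>
        (1 - b2 * r) * (1 - b3 * r) * 0 - (1 - b1 * r) * (1 - b4 * r) * 0) (at r)"
      using lim by (intro tendsto_intros)
    then show "((\<lambda>x. (x - r) * h x) \<longlongrightarrow> 0) (at r)"
      unfolding h_def by (simp add: algebra_simps)
  qed blast
  show ?thesis
  proof (rule that[of G])
    fix x assume *: "J.off x" "J.off (q * x)" "K.off (q * x)" "x \<noteq> b6 * t" "x \<noteq> t / b6"
    have "h x = poly G x"
      using Sh[OF *(1-3)] G[of x] *(4,5) nz by simp
    then show "(1 - b2 * x) * (1 - b3 * x) * K.stj (q * x) = (1 - b1 * x) * (1 - b4 * x) * J.stj x + poly G x"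
      by (simp add: h_def algebra_simps)
  next
    show "E_plus q b6 t (q * x) * poly U x + D_minus b2 b3 b6 t x * poly T (q * x) =
        q * (b6 * t - x) * (t - b6 * x) * poly G x" for x
      using G[of x] unfolding S k .
  qed
qed

theorem proposition3:
  fixes q b1 b2 b3 b4 b5 b6 t :: complex
    and n :: nat
    and \<alpha> \<beta> a0 f g :: "complex \<Rightarrow> complex"
    and p :: "complex \<Rightarrow> nat \<Rightarrow> complex poly"
    and Wp Tp Tm Wm :: "complex \<Rightarrow> complex poly"
  assumes q: "0 < norm q" "norm q < 1"
    and b_nz: "b1 \<noteq> 0" "b2 \<noteq> 0" "b3 \<noteq> 0" "b4 \<noteq> 0" "b6 \<noteq> 0"
    and b_prod: "b1 * b2 * b3 * b4 = 1"
    and b5: "b5 = b1 * b4 * b6 * q ^ n"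
    and t_nz: "t \<noteq> 0"
    and x_eq: "\<And>s. s \<in> {t, q * t} \<Longrightarrow>
      x_equation q (\<alpha> s) (\<beta> s) (weight q b1 b2 b3 b4 b6 s) (D_plus b1 b4 b6 s) (D_minus b2 b3 b6 s)"
    and t_eq: "t_equation q t
      (\<alpha> t) (\<beta> t) (weight q b1 b2 b3 b4 b6 t)
      (\<alpha> (q * t)) (\<beta> (q * t)) (weight q b1 b2 b3 b4 b6 (q * t))
      (E_plus q b6 t) (E_minus q b6 t)"
    and orth: "\<And>s. s \<in> {t, q * t} \<Longrightarrow>
      orthonormal_polys q (\<alpha> s) (\<beta> s) (weight q b1 b2 b3 b4 b6 s) (p s)"
    and a0_nz: "\<And>s. s \<in> {t, q * t} \<Longrightarrow> a0 s \<noteq> 0"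
    and an_nz: "\<And>s. s \<in> {t, q * t} \<Longrightarrow> rec_coeff (a0 s) (p s) n \<noteq> 0"
    and A: "\<And>s. s \<in> {t, q * t} \<Longrightarrow>
      spectral_matrix q (\<alpha> s) (\<beta> s) (weight q b1 b2 b3 b4 b6 s) (D_plus b1 b4 b6 s) (a0 s) (p s) n
        (Wp s) (Tp s) (Tm s) (Wm s)"
    and g_zero: "\<And>s. s \<in> {t, q * t} \<Longrightarrow> poly (Tp s div [:0, 1:]) (g s) = 0"
    and g_ne: "\<And>s. s \<in> {t, q * t} \<Longrightarrow> g s \<noteq> 0 \<and> g s \<noteq> b6 * s \<and> g s \<noteq> s / b6"
    and f_def: "\<And>s. s \<in> {t, q * t} \<Longrightarrow>
      poly (Wp s) (g s) = - (1 / s) * (g s - b6 * s) * (b6 * g s - s) * (f (s / q) * g s - 1)"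
    and b5_ne: "b5 \<noteq> 1" "b5\<^sup>2 \<noteq> 1 / q" "b5 \<noteq> 1 / q"
    and f_nz: "f t \<noteq> 0"
    and f_ne: "b5 * f t \<noteq> t" "f t \<noteq> b5 * q * t"
    and g_hat_ne: "g (q * t) \<noteq>
      (1 - q * b5 * t * g t - q * b5\<^sup>2 + q * b5\<^sup>2 * f t * g t) / (f t - b5 * q * t)"
  shows "(f t * g (q * t) - 1) * (f t * g t - 1) =
    q * t\<^sup>2 * ((f t - b1) * (f t - b2) * (f t - b3) * (f t - b4)) /
      ((f t - b5 * q * t) * (f t - t / b5))"
proof -

  \<comment> \<open>The weight and the coefficients as polynomials\<close>
  define w where "w s = weight q b1 b2 b3 b4 b6 s" for s
  have q0: "q \<noteq> 0" and nz: "q * t \<noteq> 0" "b5 \<noteq> 0" and b23: "b2 * b3 = 1 / (b1 * b4)"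
    using q b_nz b_prod b5 t_nz by (auto simp: field_simps)
  have jw: "jackson_weight q (\<alpha> s) (\<beta> s) (w s)" for s
    unfolding jackson_weight_def w_def using q(2) Bseq_tendsto[OF weight_tendsto_1[OF q(2)]] by blast
  interpret J: jackson_weight q "\<alpha> t" "\<beta> t" "w t" by (rule jw)
  interpret K: jackson_weight q "\<alpha> (q * t)" "\<beta> (q * t)" "w (q * t)" by (rule jw)
  define Dp where "Dp s = smult b6 ([:1, - b1:] * [:1, - b4:] * [:s, - b6:])" for s
  define Dm where "Dm s = [:1, - b2:] * [:1, - b3:] * [:b6 * s, - 1:]" for s
  define Ep where "Ep = [:q * t, - 1 / b6:]"
  define Em where "Em = [:q * t, - b6:]"
  define Fp where "Fp = [:1, - b1:] * [:1, - b4:]"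
  define Fm where "Fm = [:1, - b2:] * [:1, - b3:]"
  have Dp: "poly (Dp s) = D_plus b1 b4 b6 s" and Dm: "poly (Dm s) = D_minus b2 b3 b6 s" for s
    by (simp_all add: fun_eq_iff Dp_def Dm_def D_plus_def D_minus_def algebra_simps)
  have Ep: "poly Ep = E_plus q b6 t" and Em: "poly Em = E_minus q b6 t"
    using b_nz by (simp_all add: fun_eq_iff Ep_def Em_def E_plus_def E_minus_def field_simps)
  have Fp: "poly Fp x = (1 - b1 * x) * (1 - b4 * x)" and Fm: "poly Fm x = (1 - b2 * x) * (1 - b3 * x)" for x
    by (simp_all add: Fp_def Fm_def algebra_simps)
  have coeffs: "coeff (Dp s) 3 = - b1 * b4 * b6\<^sup>2" "coeff (Dm s) 3 = - b2 * b3"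
    "coeff Ep 1 = - 1 / b6" "coeff Em 1 = - b6" "coeff Fp 2 = b1 * b4" "coeff Fm 2 = b2 * b3" for s
    by (simp_all add: Dp_def Dm_def Ep_def Em_def Fp_def Fm_def numeral_2_eq_2 numeral_3_eq_3 power2_eq_square)
  have degs: "degree (Dp s) \<le> 3" "degree (Dm s) \<le> 3" "degree Ep \<le> 1" "degree Em \<le> 1"
    "degree Fp \<le> 2" "degree Fm \<le> 2" for s
    by (simp_all add: Dp_def Dm_def Ep_def Em_def Fp_def Fm_def)
  have w_rel: "poly (Dm s) x * w s (q * x) = poly (Dp s) x * w s x" if "s \<noteq> 0" "w s x \<noteq> 0" for s x
    unfolding Dp Dm w_def using weight_q_shift[OF q(2) b_nz(5) that(1)] that(2) by (simp add: w_def)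

  \<comment> \<open>The three relations between Stieltjes functions\<close>
  obtain U where U: "\<And>x. J.off x \<Longrightarrow> J.off (q * x) \<Longrightarrow> poly (Dm t) x * J.stj (q * x) =
      poly (Dp t) x * J.stj x + poly (smult (q - 1) ([:0, 1:] * U)) x"
    using x_eq[of t] unfolding x_equation_def Dp Dm w_def by (auto simp: mult_ac)
  obtain Uh where Uh: "\<And>x. K.off x \<Longrightarrow> K.off (q * x) \<Longrightarrow> poly (Dm (q * t)) x * K.stj (q * x) =
      poly (Dp (q * t)) x * K.stj x + poly (smult (q - 1) ([:0, 1:] * Uh)) x"
    using x_eq[of "q * t"] unfolding x_equation_def Dp Dm w_def by (auto simp: mult_ac)
  obtain T where T: "\<And>x. J.off x \<Longrightarrow> K.off x \<Longrightarrow>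
      poly Em x * K.stj x = poly Ep x * J.stj x + poly (smult ((q - 1) * t) T) x"
    using t_eq unfolding t_equation_def Ep Em w_def by auto
  \<comment> \<open>The factor \<open>x\<close> kept in \<open>CU\<close> and \<open>CUh\<close>
    makes them vanish at 0; the evaluations at \<open>x = 0\<close> rest on this.\<close>
  define CU where "CU = smult (q - 1) ([:0, 1:] * U)"
  define CUh where "CUh = smult (q - 1) ([:0, 1:] * Uh)"
  define CT where "CT = smult ((q - 1) * t) T"
  note U = U[folded CU_def] and Uh = Uh[folded CUh_def] and T = T[folded CT_def]
  have w0: "w t r = 0 \<and> w (q * t) (q * r) = 0" if "r \<in> {b6 * t, t / b6}" for r
    unfolding w_def using that b_nz nz t_nz
    by (auto intro!: weight_eq_0 q(2))
  obtain G where
    G: "\<And>x. J.off x \<Longrightarrow> J.off (q * x) \<Longrightarrow> K.off (q * x) \<Longrightarrow> x \<noteq> b6 * t \<Longrightarrow> x \<noteq> t / b6 \<Longrightarrow>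
      poly Fm x * K.stj (q * x) = poly Fp x * J.stj x + poly G x"
    and GC: "\<And>x. poly Ep (q * x) * poly CU x + poly (Dm t) x * poly CT (q * x) =
      q * (b6 * t - x) * (t - b6 * x) * poly G x"
  proof (rule stieltjes_diagonal_shift[OF jw jw q0 t_nz b_nz(5) w0 U[unfolded Dp Dm] T[unfolded Ep Em]])
    fix G
    assume 1: "\<And>x. J.off x \<Longrightarrow> J.off (q * x) \<Longrightarrow> K.off (q * x) \<Longrightarrow> x \<noteq> b6 * t \<Longrightarrow> x \<noteq> t / b6 \<Longrightarrow>
        (1 - b2 * x) * (1 - b3 * x) * K.stj (q * x) = (1 - b1 * x) * (1 - b4 * x) * J.stj x + poly G x"
      and 2: "\<And>x. E_plus q b6 t (q * x) * poly CU x + D_minus b2 b3 b6 t x * poly CT (q * x) =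
        q * (b6 * t - x) * (t - b6 * x) * poly G x"
    show thesis
    proof (rule that[of G])
      show "poly Fm x * K.stj (q * x) = poly Fp x * J.stj x + poly G x"
        if "J.off x" "J.off (q * x)" "K.off (q * x)" "x \<noteq> b6 * t" "x \<noteq> t / b6" for x
        unfolding Fm Fp using that by (rule 1)
      show "poly Ep (q * x) * poly CU x + poly (Dm t) x * poly CT (q * x) =
        q * (b6 * t - x) * (t - b6 * x) * poly G x" for x
        unfolding Ep Dm by (rule 2)
    qed
  qed

  \<comment> \<open>Fundamental systems and spectral matrices at \<open>t\<close> and
    \<open>q * t\<close>\<close>
  have lattice: "t \<in> {t, q * t}" "q * t \<in> {t, q * t}" by simp_all
  have orth': "orthonormal_polys q (\<alpha> s) (\<beta> s) (w s) (p s)" if "s \<in> {t, q * t}" for s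
    unfolding w_def using that by (rule orth)
  obtain P' R R' \<gamma> \<gamma>' where \<gamma>: "\<gamma> \<noteq> 0" "\<gamma>' \<noteq> 0"
    and fund: "fundamental n J.stj (p t n) P' R R' \<gamma> (1 / \<gamma>) (1 / \<gamma>')"
    and Y: "\<And>x. J.off x \<Longrightarrow> Y_matrix q (\<alpha> t) (\<beta> t) (w t) (a0 t) (p t) n x =
      vector [vector [poly (p t n) x, (poly (p t n) x * J.stj x - poly R x) / w t x],
              vector [poly P' x, (poly P' x * J.stj x - poly R' x) / w t x]]"
    by (rule J.orthonormal_fundamental[OF orth'[OF lattice(1)] a0_nz[OF lattice(1)], where n = n]) (rule that)
  obtain Ph' Rh Rh' \<gamma>h \<gamma>h' where \<gamma>h: "\<gamma>h \<noteq> 0" "\<gamma>h' \<noteq> 0"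
    and fundh: "fundamental n K.stj (p (q * t) n) Ph' Rh Rh' \<gamma>h (1 / \<gamma>h) (1 / \<gamma>h')"
    and Yh: "\<And>x. K.off x \<Longrightarrow> Y_matrix q (\<alpha> (q * t)) (\<beta> (q * t)) (w (q * t)) (a0 (q * t)) (p (q * t)) n x =
      vector [vector [poly (p (q * t) n) x, (poly (p (q * t) n) x * K.stj x - poly Rh x) / w (q * t) x],
              vector [poly Ph' x, (poly Ph' x * K.stj x - poly Rh' x) / w (q * t) x]]"
    by (rule K.orthonormal_fundamental[OF orth'[OF lattice(2)] a0_nz[OF lattice(2)], where n = n]) (rule that)
  define P where "P = p t n"
  define Ph where "Ph = p (q * t) n"
  note fund = fund[folded P_def] and fundh = fundh[folded Ph_def]
  have cas: "poly P' x * poly R x - poly P x * poly R' x = \<gamma> / \<gamma>'"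
    and cash: "poly Ph' x * poly Rh x - poly Ph x * poly Rh' x = \<gamma>h / \<gamma>h'" for x
    using fundamental_casoratian[OF fund] fundamental_casoratian[OF fundh] by simp_all
  have cas_nz: "poly P' x * poly R x - poly P x * poly R' x \<noteq> 0"
    "poly Ph' x * poly Rh x - poly Ph x * poly Rh' x \<noteq> 0" for x
    unfolding cas cash using \<gamma> \<gamma>h by simp_all
  have zeros: "countable {x. w s x = 0}" for s
    unfolding w_def by (rule countable_weight_zeros[OF q(2)])
  have A': "spectral_matrix q (\<alpha> s) (\<beta> s) (w s) (poly (Dp s)) (a0 s) (p s) n (Wp s) (Tp s) (Tm s) (Wm s)"
    if "s \<in> {t, q * t}" for s
    using A[OF that] by (simp add: w_def Dp)
  note rows = J.spectral_matrix_rows[OF Y A'[OF lattice(1)] U w_rel[OF t_nz] zeros q0, folded P_def]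
  note rowsh = K.spectral_matrix_rows[OF Yh A'[OF lattice(2)] Uh w_rel[OF nz(1)] zeros q0, folded Ph_def]

  have dil: "filterlim (\<lambda>x. q * x) at_infinity at_infinity"
    using q0 by (intro tendsto_mult_filterlim_at_infinity[of _ q] filterlim_ident) auto
  have off_dil: "eventually (\<lambda>x. J.off (q * x)) at_infinity" "eventually (\<lambda>x. K.off (q * x)) at_infinity"
    using dil J.eventually_off_at_infinity K.eventually_off_at_infinity unfolding filterlim_iff by blast+
  have ne_inf: "eventually (\<lambda>x. x \<noteq> r) at_infinity" for r :: complex
    by (rule eventually_at_infinityI[of "norm r + 1"]) auto
  have pc: "poly (r \<circ>\<^sub>p [:0, q:]) x = poly r (q * x)" for r x
    by (simp add: poly_pcompose mult.commute)
  note pot = poly_over_power_tendsto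

  \<comment> \<open>The deformation matrix \<open>B\<close> and the diagonal shift
    \<open>N\<close>\<close>
  define u where "u = \<gamma>h / \<gamma>"
  define v where "v = \<gamma>' / \<gamma>h'"
  have uv_nz: "u \<noteq> 0" "v \<noteq> 0" using \<gamma> \<gamma>h by (auto simp: u_def v_def)
  obtain B11 B12 B21 B22 where B:
    "\<And>x. poly Ep x * poly Ph x = poly B11 x * poly P x + poly B12 x * poly P' x"
    "\<And>x. poly Em x * poly Rh x - poly CT x * poly Ph x = poly B11 x * poly R x + poly B12 x * poly R' x"
    "\<And>x. poly Ep x * poly Ph' x = poly B21 x * poly P x + poly B22 x * poly P' x"
    "\<And>x. poly Em x * poly Rh' x - poly CT x * poly Ph' x = poly B21 x * poly R x + poly B22 x * poly R' x"
    and B_deg: "degree B11 \<le> 1" "coeff B11 1 = - u / b6" "degree B12 \<le> 0" "degree B22 \<le> 1" "coeff B22 1 = - b6 * v"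
  proof (rule transfer_matrix[OF fund fundh, of Em Ep CT 0 "- 1 / b6" "- b6"])
    show "eventually (\<lambda>x. poly Em x * K.stj x = poly Ep x * J.stj x + poly CT x) at_infinity"
      using J.eventually_off_at_infinity K.eventually_off_at_infinity by eventually_elim (rule T)
    show "((\<lambda>x. poly Ep x / x ^ Suc 0) \<longlongrightarrow> - 1 / b6) at_infinity"
      "((\<lambda>x. poly Em x / x ^ Suc 0) \<longlongrightarrow> - b6) at_infinity"
      using pot[OF degs(3)] pot[OF degs(4)] coeffs by simp_all
  qed (use \<gamma> \<gamma>h in \<open>auto simp: u_def v_def\<close>)

  \<comment> \<open>The dilation contributes \<open>q ^ n\<close> to the first diagonal leading
    coefficient and its inverse to the second; with \<open>b2 * b3 = 1 / (b1 * b4)\<close> these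
    combine to \<open>b5 / b6\<close> and \<open>b6 / b5\<close>.\<close>
  obtain N11 N12 N21 N22 where N:
    "\<And>x. poly Fp x * poly Ph (q * x) = poly N11 x * poly P x + poly N12 x * poly P' x"
    "\<And>x. poly Fm x * poly Rh (q * x) - poly G x * poly Ph (q * x) = poly N11 x * poly R x + poly N12 x * poly R' x"
    "\<And>x. poly Fp x * poly Ph' (q * x) = poly N21 x * poly P x + poly N22 x * poly P' x"
    "\<And>x. poly Fm x * poly Rh' (q * x) - poly G x * poly Ph' (q * x) = poly N21 x * poly R x + poly N22 x * poly R' x"
    and N_deg: "degree N11 \<le> 2" "coeff N11 2 = b5 / b6 * u" "degree N12 \<le> 1" "degree N22 \<le> 2" "coeff N22 2 = b6 / b5 * v"
  proof (rule transfer_matrix[OF fund fundamental_dilate[OF fundh q0], of Fm Fp G 1 "b1 * b4" "b2 * b3"])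
    show "eventually (\<lambda>x. poly Fm x * K.stj (q * x) = poly Fp x * J.stj x + poly G x) at_infinity"
      using J.eventually_off_at_infinity off_dil ne_inf[of "b6 * t"] ne_inf[of "t / b6"]
      by eventually_elim (rule G)
    show "((\<lambda>x. poly Fp x / x ^ Suc 1) \<longlongrightarrow> b1 * b4) at_infinity"
      "((\<lambda>x. poly Fm x / x ^ Suc 1) \<longlongrightarrow> b2 * b3) at_infinity"
      using pot[OF degs(5)] pot[OF degs(6)] coeffs by (simp_all add: numeral_2_eq_2)
  qed (use \<gamma> \<gamma>h q0 b_nz in \<open>auto simp: pc u_def v_def b5 b23 numeral_2_eq_2 field_simps\<close>)

  \<comment> \<open>Uniqueness identifies \<open>- Tp t\<close> with an entry computed by
    \<open>transfer_matrix\<close>, whose coefficient of \<open>x\<close> squared is a nonzero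
    multiple of \<open>q * b5\<^sup>2 - 1\<close>.\<close>
  have T_nz: "Tp t \<noteq> 0"
  proof (rule transfer_matrix[OF fund fundamental_dilate[OF fund q0], of "Dm t" "Dp t" CU 2 "- b1 * b4 * b6\<^sup>2" "- b2 * b3"])
    show "eventually (\<lambda>x. poly (Dm t) x * J.stj (q * x) = poly (Dp t) x * J.stj x + poly CU x) at_infinity"
      using J.eventually_off_at_infinity off_dil(1) by eventually_elim (rule U)
    show "((\<lambda>x. poly (Dp t) x / x ^ Suc 2) \<longlongrightarrow> - b1 * b4 * b6\<^sup>2) at_infinity"
      "((\<lambda>x. poly (Dm t) x / x ^ Suc 2) \<longlongrightarrow> - b2 * b3) at_infinity"
      using pot[OF degs(1)] pot[OF degs(2)] coeffs by (simp_all add: numeral_3_eq_3 numeral_2_eq_2)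
    show "\<gamma> \<noteq> 0" "1 / \<gamma>' \<noteq> 0" using \<gamma> by auto
    fix M11 M12 M21 M22
    assume M: "\<And>x. poly (Dp t) x * poly (P \<circ>\<^sub>p [:0, q:]) x = poly M11 x * poly P x + poly M12 x * poly P' x"
      "\<And>x. poly (Dm t) x * poly (R \<circ>\<^sub>p [:0, q:]) x - poly CU x * poly (P \<circ>\<^sub>p [:0, q:]) x =
        poly M11 x * poly R x + poly M12 x * poly R' x"
    have "poly M12 x = - poly (Tp t) x" for x
      by (rule transfer_unique(2)[OF cas_nz(1)[of x], of "poly M11 x" _ "poly (Wp t) x"])
        (use M[of x] rows(1,2)[of x] in \<open>simp_all add: pc\<close>)
    then have M12: "M12 = - Tp t" by (simp add: poly_eq_poly_eq_iff[symmetric] fun_eq_iff)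
    assume "coeff M12 2 = (- b2 * b3 * (1 / \<gamma> / q ^ Suc n) * \<gamma> - - b1 * b4 * b6\<^sup>2 * (q ^ n * \<gamma>) * (1 / \<gamma>)) / (\<gamma> * (1 / \<gamma>'))"
    also have "\<dots> = \<gamma>' / \<gamma> * (b6 / (q * b5)) * (q * b5\<^sup>2 - 1)"
      unfolding b5 using \<gamma> q0 b_nz b23 by (simp add: field_simps power2_eq_square)
    also have "\<dots> \<noteq> 0" using \<gamma> q0 b_nz nz b5_ne(2) by (simp add: field_simps)
    finally show ?thesis unfolding M12 by auto
  qed

  \<comment> \<open>At \<open>x = 0\<close> both diagonal factors are \<open>b6 * t\<close> and
    \<open>CU\<close> vanishes, so the spectral matrix is scalar there. Hence \<open>Tp\<close> is
    divisible by \<open>x\<close>, and zeros of the quotient are zeros of \<open>Tp\<close>.\<close>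
  have T0: "poly (Tp t) 0 = 0"
    using transfer_unique(2)[OF cas_nz(1)[of 0], of "poly (Wp t) 0" "- poly (Tp t) 0" "b6 * t" 0]
      rows(1,2)[of 0] by (simp add: Dp_def Dm_def CU_def)
  have Th0: "poly (Tp (q * t)) 0 = 0"
    using transfer_unique(2)[OF cas_nz(2)[of 0], of "poly (Wp (q * t)) 0" "- poly (Tp (q * t)) 0" "b6 * (q * t)" 0]
      rowsh(1,2)[of 0] by (simp add: Dp_def Dm_def CUh_def)
  have root: "poly r y = 0" if "poly r 0 = 0" "poly (r div [:0, 1:]) y = 0" for r and y :: complex
  proof -
    have "[:0, 1:] dvd r" using that(1) poly_eq_0_iff_dvd[of r 0] by simp
    then have "poly r y = poly ([:0, 1:] * (r div [:0, 1:])) y"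
      by (simp only: dvd_mult_div_cancel)
    then show ?thesis unfolding poly_mult that(2) by simp
  qed
  have Tg: "poly (Tp t) (g t) = 0" and Tgh: "poly (Tp (q * t)) (g (q * t)) = 0"
    using root[OF T0] root[OF Th0] g_zero by auto

  \<comment> \<open>Compatibility of the spectral matrix with \<open>B\<close> and
    \<open>N\<close>\<close>
  have BA: "- poly B11 (q * x) * poly (Tp t) x + poly B12 (q * x) * poly (Wm t) x =
      q * (b6 * t - x) * (t - b6 * x) * poly N12 x"
    "- poly B21 (q * x) * poly (Tp t) x + poly B22 (q * x) * poly (Wm t) x =
      q * (b6 * t - x) * (t - b6 * x) * poly N22 x" for x
  proof -
    have e: "poly (Dp t) x * poly Ep (q * x) = q * (b6 * t - x) * (t - b6 * x) * poly Fp x"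
      "poly (Dm t) x * poly Em (q * x) = q * (b6 * t - x) * (t - b6 * x) * poly Fm x"
      using b_nz unfolding Dp Dm Ep Em Fp Fm
      by (simp_all add: D_plus_def D_minus_def E_plus_def E_minus_def field_simps)
    have c: "poly (Dm t) x * poly CT (q * x) + poly Ep (q * x) * poly CU x =
        q * (b6 * t - x) * (t - b6 * x) * poly G x"
      using GC[of x] by (simp add: add.commute)
    have r: "poly (Dp t) x * poly P (q * x) = poly (Wp t) x * poly P x + (- poly (Tp t) x) * poly P' x"
      "poly (Dm t) x * poly R (q * x) - poly CU x * poly P (q * x) = poly (Wp t) x * poly R x + (- poly (Tp t) x) * poly R' x"
      using rows(1,2)[of x] by simp_all
    show "- poly B11 (q * x) * poly (Tp t) x + poly B12 (q * x) * poly (Wm t) x =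
        q * (b6 * t - x) * (t - b6 * x) * poly N12 x"
      using transfer_compose(2)[OF cas_nz(1) r rows(3,4) B(1,2)[of "q * x"] N(1,2)[of x] e c] by simp
    show "- poly B21 (q * x) * poly (Tp t) x + poly B22 (q * x) * poly (Wm t) x =
        q * (b6 * t - x) * (t - b6 * x) * poly N22 x"
      using transfer_compose(2)[OF cas_nz(1) r rows(3,4) B(3,4)[of "q * x"] N(3,4)[of x] e c] by simp
  qed

  have eh: "poly Ep x * poly (Dp (q * t)) x = (q * t - b6 * x) * (b6 * (q * t) - x) * poly Fp x"
    "poly Em x * poly (Dm (q * t)) x = (q * t - b6 * x) * (b6 * (q * t) - x) * poly Fm x" for x
    using b_nz unfolding Dp Dm Ep Em Fp Fm
    by (simp_all add: D_plus_def D_minus_def E_plus_def E_minus_def field_simps)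
  \<comment> \<open>The Stieltjes function at \<open>(x, q * t)\<close> cancels on the left, and
    what remains is the diagonal-shift relation times the common factor. The identity then extends
    from the complement of a countable set.\<close>
  have GCh: "poly Em x * poly CUh x + poly (Dp (q * t)) x * poly CT x =
      (q * t - b6 * x) * (b6 * (q * t) - x) * poly G x" for x
  proof -
    have kG: "poly ([:q * t, - b6:] * [:b6 * (q * t), - 1:] * G) x =
        (q * t - b6 * x) * (b6 * (q * t) - x) * poly G x" for x
      by (simp add: algebra_simps)
    define Z where "Z = {x. \<not> J.off x} \<union> {x. \<not> K.off x} \<union> {x. \<not> J.off (q * x)} \<union> {x. \<not> K.off (q * x)} \<union>
      {b6 * t, t / b6}"
    have "countable Z"
      unfolding Z_def using J.countable_not_off K.countable_not_off
        countable_dilated[OF J.countable_not_off q0] countable_dilated[OF K.countable_not_off q0] by simp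
    moreover have "poly (Em * CUh + Dp (q * t) * CT) x =
        poly ([:q * t, - b6:] * [:b6 * (q * t), - 1:] * G) x" if "x \<notin> Z" for x
    proof -
      have x: "J.off x" "K.off x" "J.off (q * x)" "K.off (q * x)" "x \<noteq> b6 * t" "x \<noteq> t / b6"
        using that by (auto simp: Z_def)
      let ?k = "(q * t - b6 * x) * (b6 * (q * t) - x)"
      have "poly Em x * poly CUh x + poly (Dp (q * t)) x * poly CT x =
          poly Em x * (poly (Dm (q * t)) x * K.stj (q * x) - poly (Dp (q * t)) x * K.stj x) +
          poly (Dp (q * t)) x * (poly Em x * K.stj x - poly Ep x * J.stj x)"
        using Uh[OF x(2,4)] T[OF x(1,2)] by simp
      also have "\<dots> = (poly Em x * poly (Dm (q * t)) x) * K.stj (q * x) - (poly Ep x * poly (Dp (q * t)) x) * J.stj x"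
        by (simp add: algebra_simps)
      also have "\<dots> = ?k * (poly Fm x * K.stj (q * x) - poly Fp x * J.stj x)"
        unfolding eh by (simp only: right_diff_distrib mult.assoc)
      also have "\<dots> = ?k * poly G x" unfolding G[OF x(1,3-6)] by simp
      finally show ?thesis unfolding kG by simp
    qed
    ultimately have "Em * CUh + Dp (q * t) * CT = [:q * t, - b6:] * [:b6 * (q * t), - 1:] * G"
      by (rule poly_eq_of_countable)
    from arg_cong[OF this, of "\<lambda>r. poly r x"] show ?thesis unfolding kG by simp
  qed
  have AB: "poly (Wp (q * t)) x * poly B11 x - poly (Tp (q * t)) x * poly B21 x =
      (q * t - b6 * x) * (b6 * (q * t) - x) * poly N11 x"
    "poly (Wp (q * t)) x * poly B12 x - poly (Tp (q * t)) x * poly B22 x =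
      (q * t - b6 * x) * (b6 * (q * t) - x) * poly N12 x" for x
  proof -
    have r: "poly (Dp (q * t)) x * poly Ph (q * x) = poly (Wp (q * t)) x * poly Ph x + (- poly (Tp (q * t)) x) * poly Ph' x"
      "poly (Dm (q * t)) x * poly Rh (q * x) - poly CUh x * poly Ph (q * x) =
        poly (Wp (q * t)) x * poly Rh x + (- poly (Tp (q * t)) x) * poly Rh' x"
      using rowsh(1,2)[of x] by simp_all
    show "poly (Wp (q * t)) x * poly B11 x - poly (Tp (q * t)) x * poly B21 x =
        (q * t - b6 * x) * (b6 * (q * t) - x) * poly N11 x"
      using transfer_compose(1)[OF cas_nz(1) B(1-4)[of x] r N(1,2)[of x] eh GCh] by simp
    show "poly (Wp (q * t)) x * poly B12 x - poly (Tp (q * t)) x * poly B22 x =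
        (q * t - b6 * x) * (b6 * (q * t) - x) * poly N12 x"
      using transfer_compose(2)[OF cas_nz(1) B(1-4)[of x] r N(1,2)[of x] eh GCh] by simp
  qed

  \<comment> \<open>Coefficients of \<open>B\<close> and \<open>N\<close>, and evaluation at the
    zeros of \<open>Tp\<close>\<close>
  define c c' b where "c = coeff B11 0" and "c' = coeff B22 0" and "b = coeff B12 0"
  define n1 n2 m where "n1 = coeff N11 1" and "n2 = coeff N12 1" and "m = coeff N22 1"
  \<comment> \<open>At \<open>x = 0\<close> dilation has no effect, \<open>Ep\<close> and
    \<open>Em\<close> equal \<open>q * t\<close>, and \<open>Fp\<close> and \<open>Fm\<close> equal
    1. So \<open>B\<close> and \<open>q * t\<close> times \<open>N\<close> express the same rows
    once \<open>CT\<close> and \<open>G\<close> are matched.\<close>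
  have at_0: "poly B11 0 = q * t * poly N11 0" "poly B12 0 = q * t * poly N12 0" "poly B22 0 = q * t * poly N22 0"
  proof -
    have "t * b6 * poly CT 0 = t * b6 * (q * t * poly G 0)"
      using GC[of 0] by (simp add: CU_def Dm_def mult_ac)
    then have CT0: "poly CT 0 = q * t * poly G 0" using t_nz b_nz by simp
    have E0: "poly Ep 0 = q * t" "poly Em 0 = q * t" "poly Fp 0 = 1" "poly Fm 0 = 1"
      by (simp_all add: Ep_def Em_def Fp_def Fm_def)
    have 1: "poly B11 0 * poly P 0 + poly B12 0 * poly P' 0 = (q * t * poly N11 0) * poly P 0 + (q * t * poly N12 0) * poly P' 0"
      using B(1)[of 0] N(1)[of 0] unfolding E0 by (simp add: algebra_simps)
    have 2: "poly B11 0 * poly R 0 + poly B12 0 * poly R' 0 = (q * t * poly N11 0) * poly R 0 + (q * t * poly N12 0) * poly R' 0"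
      using B(2)[of 0] N(2)[of 0] unfolding E0 CT0
      by (simp add: algebra_simps)
    have 3: "poly B21 0 * poly P 0 + poly B22 0 * poly P' 0 = (q * t * poly N21 0) * poly P 0 + (q * t * poly N22 0) * poly P' 0"
      using B(3)[of 0] N(3)[of 0] unfolding E0 by (simp add: algebra_simps)
    have 4: "poly B21 0 * poly R 0 + poly B22 0 * poly R' 0 = (q * t * poly N21 0) * poly R 0 + (q * t * poly N22 0) * poly R' 0"
      using B(4)[of 0] N(4)[of 0] unfolding E0 CT0
      by (simp add: algebra_simps)
    show "poly B11 0 = q * t * poly N11 0" "poly B12 0 = q * t * poly N12 0" "poly B22 0 = q * t * poly N22 0"
      using transfer_unique[OF cas_nz(1) 1 2] transfer_unique[OF cas_nz(1) 3 4] by blast+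
  qed
  have B_eq: "poly B11 = (\<lambda>x. c - u / b6 * x)" "poly B12 = (\<lambda>x. b)" "poly B22 = (\<lambda>x. c' - b6 * v * x)"
    using B_deg by (simp_all add: fun_eq_iff poly_eq_sum_atMost[OF B_deg(1)]
        poly_eq_sum_atMost[OF B_deg(3)] poly_eq_sum_atMost[OF B_deg(4)] c_def c'_def b_def)
  have N_eq: "poly N11 = (\<lambda>x. c / (q * t) + n1 * x + b5 / b6 * u * x\<^sup>2)"
    "poly N12 = (\<lambda>x. b / (q * t) + n2 * x)" "poly N22 = (\<lambda>x. c' / (q * t) + m * x + b6 / b5 * v * x\<^sup>2)"
    using N_deg at_0 nz(1)
    by (simp_all add: fun_eq_iff poly_eq_sum_atMost[OF N_deg(1)]
        poly_eq_sum_atMost[OF N_deg(3)] poly_eq_sum_atMost[OF N_deg(4)] numeral_2_eq_2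
        c_def c'_def b_def n1_def n2_def m_def poly_0_coeff_0)

  define gh where "gh = g (q * t)"
  have g: "g t \<noteq> 0" "g t \<noteq> b6 * t" "g t \<noteq> t / b6" and gh: "gh \<noteq> 0" "gh \<noteq> b6 * (q * t)" "gh \<noteq> q * t / b6"
    using g_ne by (auto simp: gh_def)
  \<comment> \<open>The definition of \<open>f\<close> at the point \<open>q * t\<close> involves
    \<open>f (q * t / q)\<close>, which is why \<open>f t\<close> is paired with
    \<open>gh\<close>.\<close>
  have Wgh: "poly (Wp (q * t)) gh = (q * t - b6 * gh) * (b6 * (q * t) - gh) * (- (f t * gh - 1) / (q * t))"
  proof -
    have "poly (Wp (q * t)) gh = - (1 / (q * t)) * (gh - b6 * (q * t)) * (b6 * gh - q * t) * (f (q * t / q) * gh - 1)"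
      unfolding gh_def by (rule f_def) simp
    also have "q * t / q = t" using q0 by simp
    finally show ?thesis using nz(1) by (simp add: field_simps)
  qed
  have kh: "(q * t - b6 * gh) * (b6 * (q * t) - gh) \<noteq> 0"
  proof -
    have "q * t - b6 * gh \<noteq> 0" using gh(3) b_nz by (auto simp: field_simps)
    then show ?thesis using gh(2) by simp
  qed
  have at_gh: "poly N11 gh = - (f t * gh - 1) / (q * t) * poly B11 gh"
    "poly N12 gh = - (f t * gh - 1) / (q * t) * b"
  proof -
    have cancel: "y = a * z" if "(k * a) * z - 0 * z' = k * y" "k \<noteq> 0" for k a z z' y :: complex
      using that by simp
    show "poly N11 gh = - (f t * gh - 1) / (q * t) * poly B11 gh"
      by (rule cancel[OF AB(1)[of gh, unfolded Wgh Tgh[folded gh_def]] kh])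
    show "poly N12 gh = - (f t * gh - 1) / (q * t) * b"
      using cancel[OF AB(2)[of gh, unfolded Wgh Tgh[folded gh_def]] kh] by (simp add: B_eq(2))
  qed
  \<comment> \<open>If \<open>b = 0\<close>, then \<open>N12\<close> vanishes at 0 and at
    \<open>gh\<close>, hence identically, and \<open>BA\<close> leaves the product of
    \<open>B11\<close> at \<open>q * x\<close> and \<open>Tp t\<close> equal to 0. But
    \<open>Tp t\<close> is nonzero and \<open>B11\<close> has slope \<open>- u / b6\<close>.\<close>
  have b_nz': "b \<noteq> 0"
  proof
    assume b: "b = 0"
    then have "n2 * gh = 0" using at_gh(2) by (simp add: N_eq(2))
    then have "poly N12 x = 0" for x using b gh by (simp add: N_eq(2))
    then have "poly ((B11 \<circ>\<^sub>p [:0, q:]) * Tp t) x = 0" for x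
      using BA(1)[of x] b by (simp add: pc B_eq(2))
    then have "(B11 \<circ>\<^sub>p [:0, q:]) * Tp t = 0" by (metis poly_all_0_iff_0)
    then have "B11 \<circ>\<^sub>p [:0, q:] = 0" using T_nz by simp
    then have z: "poly B11 (q * x) = 0" for x by (metis pc poly_0)
    have "u / b6 * q = poly B11 (q * 0) - poly B11 (q * 1)" by (simp add: B_eq(1))
    then show False unfolding z using uv_nz b_nz q0 by simp
  qed
  \<comment> \<open>With \<open>Tp\<close> zero at \<open>g t\<close>, both relations in
    \<open>BA\<close> contain only \<open>Wm\<close>, which is eliminated between them.\<close>
  have at_g: "poly B22 (q * g t) * poly N12 (g t) = b * poly N22 (g t)"
  proof -
    let ?k = "q * (b6 * t - g t) * (t - b6 * g t)"
    have "t - b6 * g t \<noteq> 0" using g(3) b_nz by (auto simp: field_simps)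
    then have k: "?k \<noteq> 0" using g(2) q0 by simp
    have "b * poly (Wm t) (g t) = ?k * poly N12 (g t)" "poly B22 (q * g t) * poly (Wm t) (g t) = ?k * poly N22 (g t)"
      using BA[of "g t"] by (simp_all add: Tg B_eq(2))
    then have "?k * (poly B22 (q * g t) * poly N12 (g t)) = ?k * (b * poly N22 (g t))"
      by (metis mult.left_commute)
    then show ?thesis using k by (metis mult_left_cancel)
  qed
  define d where "d = poly Fp (1 / f t) * poly Fm (1 / f t)"
  \<comment> \<open>The quotient of the two Casoratians is \<open>u * v\<close>.\<close>
  have det: "poly N11 (1 / f t) * poly N22 (1 / f t) - poly N12 (1 / f t) * poly N21 (1 / f t) = u * v * d"
    using transfer_det[OF cas_nz(1) N(1-4)[of "1 / f t"]] \<gamma> \<gamma>h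
    unfolding cas cash d_def u_def v_def by (simp add: field_simps)
  have "(f t * gh - 1) * (f t * g t - 1) * (f t - b5 * q * t) * (f t - t / b5) = q * t\<^sup>2 * f t ^ 4 * d"
    by (rule q_painleve_algebra[OF q0 t_nz f_nz g(1) gh(1) nz(2) b_nz(5) uv_nz b_nz' B_eq(1,3) N_eq at_gh at_g det])
  moreover have "f t ^ 4 * d = (f t - b1) * (f t - b2) * (f t - b3) * (f t - b4)"
    unfolding d_def Fp Fm using f_nz by (simp add: field_simps power4_eq_xxxx)
  moreover have "f t - b5 * q * t \<noteq> 0" "f t - t / b5 \<noteq> 0"
    using f_ne nz by (auto simp: field_simps)
  ultimately show ?thesis
    unfolding gh_def by (simp add: nonzero_eq_divide_eq mult.assoc)
qed

end
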